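(* For every $\sigma\in(0,1)$ there exists a constant $C_\sigma>0$, depending only on $\sigma$, such that the following holds. Suppose that $\Omega$ is $C^2$ and satisfies the interior and exterior disk conditions with radius $\bar\rho$. If $x\in\Omega$ satisfies $d_1(x)\le\sigma\bar\rho$, then $$\left|\nabla h_\Omega(x)+\frac{\nu(s)}{2\pi d_1(x)}\right|\le\frac{C_\sigma}{\pi\bar\rho},$$ where $s\in\partial\Omega$ is the point which realises the distance of $x$ to the boundary and $\nu(s)$ is the outward-pointing unit normal to $\partial\Omega$ at $s$.
   Context: $\Omega\subset\mathbb{R}^2$ is a bounded open connected set with $C^2$ boundary, and $d_1(x)=\operatorname{dist}(x,\partial\Omega)$. The uniform interior and exterior disk conditions with radius $\bar\rho>0$ are: for every $x\in\partial\Omega$ there are unique points $x_{\mathrm{int}},x_{\mathrm{ext}}$ with $B_{\bar\rho}(x_{\mathrm{int}})\subseteq\Omega$, $B_{\bar\rho}(x_{\mathrm{ext}})\subset\Omega^c$ and $\partial B_{\bar\rho}(x_{\mathrm{int}})\cap\partial\Omega\cap\partial B_{\bar\rho}(x_{\mathrm{ext}})=\{x\}$, where $B_r(x)$ is the open disk of radius $r$ centred at $x$. (In particular each $x\in\Omega$ with $d_1(x)<\bar\rho$ has a unique closest boundary point.) The function $k_\Omega(x,y)$, for $x,y\in\Omega$, is the solution of $-\Delta_x k_\Omega(x,y)=0$ for $x\in\Omega$ and $k_\Omega(x,y)=\frac1{2\pi}\log|x-y|$ for $x\in\partial\Omega$; it is smooth and symmetric on $\Omega\times\Omega$. The function $h_\Omega$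 is defined by $h_\Omega(x):=k_\Omega(x,x)$. *)

theory Defs
  imports "HOL-Analysis.Analysis"
begin

definition C2_on :: "('a::real_normed_vector \<Rightarrow> real) \<Rightarrow> 'a set \<Rightarrow> bool" where
  "C2_on f S \<longleftrightarrow>
     (\<exists>(f' :: 'a \<Rightarrow> 'a \<Rightarrow>\<^sub>L real) (f'' :: 'a \<Rightarrow> 'a \<Rightarrow>\<^sub>L 'a \<Rightarrow>\<^sub>L real).
        (\<forall>x\<in>S. (f has_derivative blinfun_apply (f' x)) (at x)) \<and>
        (\<forall>x\<in>S. (f' has_derivative blinfun_apply (f'' x)) (at x)) \<and>
        continuous_on S f'')"

(* The sum of the pure second partial derivatives; used below for C2 functions only. *)
definition laplacian :: "('a::euclidean_space \<Rightarrow> real) \<Rightarrow> 'a \<Rightarrow> real" where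
  "laplacian u x = (\<Sum>b\<in>Basis. (deriv ^^ 2) (\<lambda>t. u (x + t *\<^sub>R b)) 0)"

(* Inside ball p r, in the orthonormal coordinates along e1 and e2, the set \<Omega> is the open
   region above the graph of g. *)
definition C2_graph_chart ::
  "(real^2) set \<Rightarrow> real^2 \<Rightarrow> real \<Rightarrow> real^2 \<Rightarrow> real^2 \<Rightarrow> (real \<Rightarrow> real) \<Rightarrow> bool" where
  "C2_graph_chart \<Omega> p r e1 e2 g \<longleftrightarrow>
     r > 0 \<and> norm e1 = 1 \<and> norm e2 = 1 \<and> e1 \<bullet> e2 = 0 \<and> C2_on g UNIV \<and>
     \<Omega> \<inter> ball p r = {z \<in> ball p r. g (z \<bullet> e1) < z \<bullet> e2}"

definition C2_boundary :: "(real^2) set \<Rightarrow> bool" where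
  "C2_boundary \<Omega> \<longleftrightarrow> (\<forall>p\<in>frontier \<Omega>. \<exists>r e1 e2 g. C2_graph_chart \<Omega> p r e1 e2 g)"

(* \<Omega> lies above the graph of g, so the outward normal is the one pointing downwards. *)
definition outward_unit_normal :: "(real^2) set \<Rightarrow> real^2 \<Rightarrow> real^2 \<Rightarrow> bool" where
  "outward_unit_normal \<Omega> p n \<longleftrightarrow>
     p \<in> frontier \<Omega> \<and>
     (\<exists>r e1 e2 g. C2_graph_chart \<Omega> p r e1 e2 g \<and>
        n = (1 / sqrt (1 + (deriv g (p \<bullet> e1))\<^sup>2)) *\<^sub>R (deriv g (p \<bullet> e1) *\<^sub>R e1 - e2))"

(* The pair c consists of the centres of the interior and of the exterior disk. *)
definition disk_conditions :: "(real^2) set \<Rightarrow> real \<Rightarrow> bool" where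
  "disk_conditions \<Omega> \<rho> \<longleftrightarrow>
     (\<forall>x\<in>frontier \<Omega>. \<exists>!c :: (real^2) \<times> (real^2).
        ball (fst c) \<rho> \<subseteq> \<Omega> \<and> ball (snd c) \<rho> \<subseteq> - \<Omega> \<and>
        sphere (fst c) \<rho> \<inter> frontier \<Omega> \<inter> sphere (snd c) \<rho> = {x})"

(* k x y is the regular part of the Green function: for each pole y in \<Omega>, the classical
   solution in x of the Dirichlet problem. By the maximum principle this determines
   k x y for x \<in> closure \<Omega> and y \<in> \<Omega> when \<Omega> is bounded. *)
definition green_regular_part :: "(real^2) set \<Rightarrow> (real^2 \<Rightarrow> real^2 \<Rightarrow> real) \<Rightarrow> bool" where
  "green_regular_part \<Omega> k \<longleftrightarrow>
     (\<forall>y\<in>\<Omega>.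
        continuous_on (closure \<Omega>) (\<lambda>x. k x y) \<and>
        C2_on (\<lambda>x. k x y) \<Omega> \<and>
        (\<forall>x\<in>\<Omega>. - laplacian (\<lambda>x. k x y) x = 0) \<and>
        (\<forall>x\<in>frontier \<Omega>. k x y = 1 / (2 * pi) * ln (norm (x - y))))"

end

(*
  Write K_c for the regular part of the Green function of the disk of radius rho about c,
  obtained by the method of images. If ce and ci are the centres of the exterior and of the
  interior disk at s, the maximum principle gives K_ci(x,x) <= k(x,x) <= K_ce(x,x) at the given
  point x, and these bounds differ by at most d / (pi rho). Hence u = K_ce - k is nonnegative and
  satisfies u(x,x) <= d / (pi rho).

  The gradient of k(z,z) is the sum of the gradients in the two variables. In the first variable u
  is a nonnegative harmonic function on the disk of radius d about x, i.e. the real part of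
  a holomorphic function, so its gradient is at most 2 u(x,x) / d. In the second variable u
  satisfies on the boundary an explicit Harnack inequality whose constant is independent of the
  boundary point; the maximum principle extends it to the domain, and differentiating it gives the
  bound 4 u(x,x) / d. Both contributions are O(1 / rho), and the gradient of K_ce(z,z) at x
  is -nu / (2 pi d) up to an error O(1 / rho).
*)
theory Submission
  imports Defs "HOL-Complex_Analysis.Complex_Analysis"
begin

text \<open>The clauses of \<open>green_regular_part\<close> say nothing about how
  \<open>k x y\<close> depends on the pole \<open>y\<close>: symmetry and smoothness in
  \<open>y\<close> are not among them, so even the existence of the gradient of \<open>k z z\<close>
  has to be derived. This is why the two variables are treated differently. In \<open>x\<close> the
  function is harmonic and complex analysis applies; in \<open>y\<close> all information comes from
  the boundary values, and what holds there uniformly in the boundary point is carried inside by the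
  maximum principle.

  A gradient bound for a nonnegative function on a disk of radius d loses a factor 1 / d; since
  \<open>u\<close> has size d / rho at the point, this loss is exactly compensated. The exterior
  disk is the right one for \<open>u\<close> because its image poles lie outside
  \<open>closure \<Omega>\<close>, so \<open>u\<close> stays harmonic and continuous up to the
  boundary. In the estimates the interior disk supplies the one inequality at (x,x) that makes
  \<open>u\<close> small.\<close>

subsection \<open>Harmonicity and the maximum principle\<close>

text \<open>Only derivatives along the coordinate lines enter: this is all that the maximum principle
  needs, and for explicit logarithms it avoids computing second Frechet derivatives.\<close>
definition harmonic_at :: "('a::euclidean_space \<Rightarrow> real) \<Rightarrow> 'a \<Rightarrow> bool" where
  "harmonic_at f x \<longleftrightarrow>
     (\<exists>g m. (\<forall>b\<in>Basis.
          (\<forall>\<^sub>F t in nhds 0. ((\<lambda>t. f (x + t *\<^sub>R b)) has_real_derivative g b t) (at t)) \<and>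
          (g b has_real_derivative m b) (at 0)) \<and>
        (\<Sum>b\<in>Basis. m b) = 0)"

lemma harmonic_at_const: "harmonic_at (\<lambda>_. c) x"
  unfolding harmonic_at_def
  by (rule exI[of _ "\<lambda>_ _. 0"], rule exI[of _ "\<lambda>_. 0"]) auto

lemma harmonic_at_add:
  assumes "harmonic_at f x" "harmonic_at g x"
  shows "harmonic_at (\<lambda>z. f z + g z) x"
proof -
  obtain f1 f2 where f: "\<And>b. b \<in> Basis \<Longrightarrow>
          (\<forall>\<^sub>F t in nhds 0. ((\<lambda>t. f (x + t *\<^sub>R b)) has_real_derivative f1 b t) (at t)) \<and>
          (f1 b has_real_derivative f2 b) (at 0)" "(\<Sum>b\<in>Basis. f2 b) = 0"
    using assms(1) unfolding harmonic_at_def by blast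
  obtain g1 g2 where g: "\<And>b. b \<in> Basis \<Longrightarrow>
          (\<forall>\<^sub>F t in nhds 0. ((\<lambda>t. g (x + t *\<^sub>R b)) has_real_derivative g1 b t) (at t)) \<and>
          (g1 b has_real_derivative g2 b) (at 0)" "(\<Sum>b\<in>Basis. g2 b) = 0"
    using assms(2) unfolding harmonic_at_def by blast
  have "(\<forall>\<^sub>F t in nhds 0. ((\<lambda>t. f (x + t *\<^sub>R b) + g (x + t *\<^sub>R b))
            has_real_derivative f1 b t + g1 b t) (at t)) \<and>
        ((\<lambda>t. f1 b t + g1 b t) has_real_derivative f2 b + g2 b) (at 0)" if "b \<in> Basis" for b
  proof
    show "\<forall>\<^sub>F t in nhds 0. ((\<lambda>t. f (x + t *\<^sub>R b) + g (x + t *\<^sub>R b))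
            has_real_derivative f1 b t + g1 b t) (at t)"
      using f(1)[OF that, THEN conjunct1] g(1)[OF that, THEN conjunct1]
      by eventually_elim (rule DERIV_add)
  next
    show "((\<lambda>t. f1 b t + g1 b t) has_real_derivative f2 b + g2 b) (at 0)"
      using f(1)[OF that] g(1)[OF that] by (auto intro: DERIV_add)
  qed
  then show ?thesis
    unfolding harmonic_at_def
    by (intro exI[of _ "\<lambda>b t. f1 b t + g1 b t"] exI[of _ "\<lambda>b. f2 b + g2 b"])
      (simp add: sum.distrib f(2) g(2))
qed

lemma harmonic_at_cmult:
  assumes "harmonic_at f x"
  shows "harmonic_at (\<lambda>z. c * f z) x"
proof -
  obtain f1 f2 where f: "\<And>b. b \<in> Basis \<Longrightarrow>
          (\<forall>\<^sub>F t in nhds 0. ((\<lambda>t. f (x + t *\<^sub>R b)) has_real_derivative f1 b t) (at t)) \<and>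
          (f1 b has_real_derivative f2 b) (at 0)" "(\<Sum>b\<in>Basis. f2 b) = 0"
    using assms(1) unfolding harmonic_at_def by blast
  have "(\<forall>\<^sub>F t in nhds 0. ((\<lambda>t. c * f (x + t *\<^sub>R b)) has_real_derivative c * f1 b t) (at t)) \<and>
        ((\<lambda>t. c * f1 b t) has_real_derivative c * f2 b) (at 0)" if "b \<in> Basis" for b
  proof
    show "\<forall>\<^sub>F t in nhds 0. ((\<lambda>t. c * f (x + t *\<^sub>R b)) has_real_derivative c * f1 b t) (at t)"
      using f(1)[OF that, THEN conjunct1] by eventually_elim (rule DERIV_cmult)
  next
    show "((\<lambda>t. c * f1 b t) has_real_derivative c * f2 b) (at 0)"
      using f(1)[OF that] by (auto intro: DERIV_cmult)
  qed
  then show ?thesis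
    unfolding harmonic_at_def
    by (intro exI[of _ "\<lambda>b t. c * f1 b t"] exI[of _ "\<lambda>b. c * f2 b"])
      (simp add: sum_distrib_left[symmetric] f(2))
qed

lemma harmonic_at_diff:
  assumes "harmonic_at f x" "harmonic_at g x"
  shows "harmonic_at (\<lambda>z. f z - g z) x"
  using harmonic_at_add[OF assms(1) harmonic_at_cmult[OF assms(2), of "-1"]] by simp

lemma harmonic_at_sum:
  assumes "\<And>i. i \<in> I \<Longrightarrow> harmonic_at (f i) x"
  shows "harmonic_at (\<lambda>z. \<Sum>i\<in>I. f i z) x"
  using assms
  by (induction I rule: infinite_finite_induct) (auto intro: harmonic_at_add harmonic_at_const)

lemmas harmonic_at_intros =
  harmonic_at_const harmonic_at_add harmonic_at_cmult harmonic_at_diff harmonic_at_sum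

lemma harmonic_at_cong:
  assumes "harmonic_at f x" "open S" "x \<in> S" "\<And>z. z \<in> S \<Longrightarrow> g z = f z"
  shows "harmonic_at g x"
proof -
  obtain f1 f2 where f: "\<And>b. b \<in> Basis \<Longrightarrow>
          (\<forall>\<^sub>F t in nhds 0. ((\<lambda>t. f (x + t *\<^sub>R b)) has_real_derivative f1 b t) (at t)) \<and>
          (f1 b has_real_derivative f2 b) (at 0)" "(\<Sum>b\<in>Basis. f2 b) = 0"
    using assms(1) unfolding harmonic_at_def by blast
  have "\<forall>\<^sub>F t in nhds 0. ((\<lambda>t. g (x + t *\<^sub>R b)) has_real_derivative f1 b t) (at t)"
    if "b \<in> Basis" for b
  proof -
    have "((\<lambda>t::real. x + t *\<^sub>R b) \<longlongrightarrow> x + 0 *\<^sub>R b) (nhds 0)"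
      by (intro tendsto_intros filterlim_ident)
    then have "\<forall>\<^sub>F t in nhds (0::real). x + t *\<^sub>R b \<in> S"
      using assms(2,3) by (simp add: tendsto_def)
    \<comment> \<open>A derivative at \<open>t\<close> depends on the values near \<open>t\<close>,
      so membership in \<open>S\<close> is needed on a neighbourhood of each \<open>t\<close> close
      to 0.\<close>
    then have "\<forall>\<^sub>F t in nhds (0::real). \<forall>\<^sub>F t' in nhds t. x + t' *\<^sub>R b \<in> S"
      by (simp add: eventually_eventually)
    then show ?thesis
      using f(1)[OF that, THEN conjunct1]
    proof eventually_elim
      case (elim t)
      have "\<forall>\<^sub>F t' in nhds t. g (x + t' *\<^sub>R b) = f (x + t' *\<^sub>R b)"
        using elim(1) by eventually_elim (simp add: assms(4))
      from DERIV_cong_ev[OF refl this refl] elim(2) show ?case by simp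
    qed
  qed
  then show ?thesis
    unfolding harmonic_at_def using f by (intro exI[of _ f1] exI[of _ f2]) simp
qed

section \<open>Harmonicity of the logarithm in the plane\<close>

lemma norm_add_scaleR_Basis_sq:
  fixes x p b :: "'a::euclidean_space"
  assumes "b \<in> Basis"
  shows "(norm (x + t *\<^sub>R b - p))\<^sup>2 = (norm (x - p))\<^sup>2 + 2 * t * ((x - p) \<bullet> b) + t\<^sup>2"
proof -
  have "x + t *\<^sub>R b - p = (x - p) + t *\<^sub>R b" by simp
  then have "(norm (x + t *\<^sub>R b - p))\<^sup>2 = (norm ((x - p) + t *\<^sub>R b))\<^sup>2" by (rule arg_cong)
  also have "\<dots> = (norm (x - p))\<^sup>2 + (norm (t *\<^sub>R b))\<^sup>2 + 2 * ((x - p) \<bullet> (t *\<^sub>R b))"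
    using dot_norm[of "x - p" "t *\<^sub>R b"] by simp
  finally show ?thesis using assms by simp
qed

text \<open>Along a coordinate line the squared norm is a quadratic polynomial. The second
  derivatives \<open>2 / N - 4 * (\<beta> b)\<^sup>2 / N\<^sup>2\<close> sum to (2 DIM - 4) / N,
  which vanishes precisely in dimension 2.\<close>

lemma harmonic_at_ln_norm_sq:
  fixes x p :: "'a::euclidean_space"
  assumes "DIM('a) = 2" "x \<noteq> p"
  shows "harmonic_at (\<lambda>z. ln ((norm (z - p))\<^sup>2)) x"
proof -
  define N where "N = (norm (x - p))\<^sup>2"
  have N: "N > 0" using assms by (simp add: N_def)
  define \<beta> where "\<beta> b = (x - p) \<bullet> b" for b
  define q where "q b t = N + 2 * t * \<beta> b + t\<^sup>2" for b and t :: real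
  have q: "(norm (x + t *\<^sub>R b - p))\<^sup>2 = q b t" if "b \<in> Basis" for b t
    using norm_add_scaleR_Basis_sq[OF that] by (simp add: q_def N_def \<beta>_def)
  have "(\<forall>\<^sub>F t in nhds 0. ((\<lambda>t. ln ((norm (x + t *\<^sub>R b - p))\<^sup>2))
            has_real_derivative (2 * \<beta> b + 2 * t) / q b t) (at t)) \<and>
        ((\<lambda>t. (2 * \<beta> b + 2 * t) / q b t) has_real_derivative
            2 / N - 4 * (\<beta> b)\<^sup>2 / N\<^sup>2) (at 0)" if b: "b \<in> Basis" for b
  proof
    have q0: "q b 0 = N" by (simp add: q_def)
    have "isCont (q b) 0" unfolding q_def by (intro continuous_intros)
    then have "(q b \<longlongrightarrow> q b 0) (nhds 0)"
      by (simp add: isCont_def tendsto_at_iff_tendsto_nhds)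
    then have ev: "\<forall>\<^sub>F t in nhds 0. q b t > 0"
      using N q0 by (simp add: order_tendstoD(1))
    show "\<forall>\<^sub>F t in nhds 0. ((\<lambda>t. ln ((norm (x + t *\<^sub>R b - p))\<^sup>2))
            has_real_derivative (2 * \<beta> b + 2 * t) / q b t) (at t)"
      using ev
    proof eventually_elim
      case (elim t)
      have d: "(q b has_real_derivative 2 * \<beta> b + 2 * t) (at t)"
        unfolding q_def by (auto intro!: derivative_eq_intros)
      show ?case
        unfolding q[OF b] using DERIV_chain2[OF DERIV_ln_divide[OF elim] d] by simp
    qed
    have d: "(q b has_real_derivative 2 * \<beta> b) (at 0)"
      unfolding q_def by (auto intro!: derivative_eq_intros)
    show "((\<lambda>t. (2 * \<beta> b + 2 * t) / q b t) has_real_derivative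
            2 / N - 4 * (\<beta> b)\<^sup>2 / N\<^sup>2) (at 0)"
    proof -
      have "((\<lambda>t. (2 * \<beta> b + 2 * t) / q b t) has_real_derivative
            (2 * q b 0 - (2 * \<beta> b + 2 * 0) * (2 * \<beta> b)) / (q b 0 * q b 0)) (at 0)"
        by (rule DERIV_divide[OF _ d]) (use q0 N in \<open>auto intro!: derivative_eq_intros\<close>)
      moreover have "(2 * q b 0 - (2 * \<beta> b + 2 * 0) * (2 * \<beta> b)) / (q b 0 * q b 0)
          = 2 / N - 4 * (\<beta> b)\<^sup>2 / N\<^sup>2"
        using N by (simp add: q0 field_simps power2_eq_square)
      ultimately show ?thesis by simp
    qed
  qed
  moreover have "(\<Sum>b\<in>Basis. 2 / N - 4 * (\<beta> b)\<^sup>2 / N\<^sup>2) = 0"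
  proof -
    have "(\<Sum>b\<in>Basis. (\<beta> b)\<^sup>2) = N"
      unfolding N_def \<beta>_def power2_norm_eq_inner
      using euclidean_inner[of "x - p" "x - p"] by (simp add: power2_eq_square)
    then have "(\<Sum>b\<in>Basis. 4 * (\<beta> b)\<^sup>2 / N\<^sup>2) = 4 * N / N\<^sup>2"
      by (simp add: sum_divide_distrib[symmetric] sum_distrib_left[symmetric])
    then show ?thesis
      using N assms(1) by (simp add: sum_subtractf power2_eq_square)
  qed
  ultimately show ?thesis
    unfolding harmonic_at_def
    by (intro exI[of _ "\<lambda>b t. (2 * \<beta> b + 2 * t) / q b t"]
        exI[of _ "\<lambda>b. 2 / N - 4 * (\<beta> b)\<^sup>2 / N\<^sup>2"]) auto
qed

text \<open>At the minimum \<open>g 0 = 0\<close>; if \<open>m < 0\<close>, then \<open>g\<close> is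
  negative just to the right of 0 and the mean value theorem pushes \<open>w\<close> below
  \<open>w 0\<close>.\<close>

lemma local_min_second_derivative_nonneg:
  fixes w g :: "real \<Rightarrow> real"
  assumes ev: "\<forall>\<^sub>F t in nhds 0. (w has_real_derivative g t) (at t)"
    and g: "(g has_real_derivative m) (at 0)"
    and mn: "\<forall>\<^sub>F t in nhds 0. w 0 \<le> w t"
  shows "m \<ge> 0"
proof (rule ccontr)
  assume "\<not> m \<ge> 0"
  then have "m < 0" by simp
  have "\<forall>\<^sub>F t in nhds 0. (w has_real_derivative g t) (at t) \<and> w 0 \<le> w t"
    using ev mn by eventually_elim simp
  then obtain e where e: "e > 0"
    "\<And>t. \<bar>t\<bar> < e \<Longrightarrow> (w has_real_derivative g t) (at t) \<and> w 0 \<le> w t"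
    unfolding eventually_nhds_metric by (auto simp: dist_real_def)
  have g0: "g 0 = 0"
    by (rule DERIV_local_min[of w "g 0" 0 e]) (use e in auto)
  obtain d where d: "d > 0" "\<And>h. 0 < h \<Longrightarrow> h < d \<Longrightarrow> g h < 0"
    using has_real_derivative_neg_dec_right[of g m 0 UNIV] g \<open>m < 0\<close> g0 by auto
  define h where "h = min d e / 2"
  have h: "0 < h" "h < d" "h < e" using d e by (auto simp: h_def)
  obtain z where z: "0 < z" "z < h" "w h - w 0 = (h - 0) * g z"
    using MVT2[of 0 h w g] h e(2) by force
  have "g z < 0" using d z h by auto
  then have "w h < w 0" using z(3) h mult_pos_neg[of h "g z"] by simp
  moreover have "w 0 \<le> w h" using e(2)[of h] h by auto
  ultimately show False by simp
qed

text \<open>A harmonic function may be flat to second order at an interior minimum, so a multiple of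
  the squared distance to \<open>a\<close> is subtracted: the second derivatives of \<open>w\<close>
  then have a strictly negative sum, which excludes an interior minimum.\<close>

lemma minimum_principle:
  fixes f :: "'a::euclidean_space \<Rightarrow> real"
  assumes V: "open V" "bounded V"
    and cont: "continuous_on (closure V) f"
    and harm: "\<And>x. x \<in> V \<Longrightarrow> harmonic_at f x"
    and bd: "\<And>x. x \<in> frontier V \<Longrightarrow> 0 \<le> f x"
    and a: "a \<in> closure V"
  shows "0 \<le> f a"
proof (rule ccontr)
  assume "\<not> 0 \<le> f a"
  then have fa: "f a < 0" by simp
  have comp: "compact (closure V)" using V by simp
  then obtain R where R: "R > 0" "\<And>x. x \<in> closure V \<Longrightarrow> norm (x - a) \<le> R"
    using bounded_any_center[of "closure V" a] compact_imp_bounded[OF comp]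
    by (metis bounded_pos dist_norm dist_commute bounded_closure V(2) 
        bounded_translation_minus image_eqI)
  \<comment> \<open>With this value \<open>\<delta> * R\<^sup>2\<close> is half of
    \<open>- f a\<close>: the perturbation cannot pull the frontier values of \<open>w\<close> down
    to the level \<open>w a = f a\<close>.\<close>
  define \<delta> where "\<delta> = - f a / (2 * R\<^sup>2)"
  have \<delta>: "\<delta> > 0" "\<delta> * R\<^sup>2 < - f a" using R(1) fa by (auto simp: \<delta>_def field_simps)
  define w where "w x = f x - \<delta> * (norm (x - a))\<^sup>2" for x
  have "continuous_on (closure V) w"
    unfolding w_def by (intro continuous_intros cont)
  then obtain z where z: "z \<in> closure V" "\<And>y. y \<in> closure V \<Longrightarrow> w z \<le> w y"
    using continuous_attains_inf[OF comp _ \<open>continuous_on (closure V) w\<close>] a by force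
  have "w z \<le> f a" using z(2)[OF a] by (simp add: w_def)
  have "z \<notin> frontier V"
  proof
    assume "z \<in> frontier V"
    then have "0 \<le> f z" by (rule bd)
    moreover have "\<delta> * (norm (z - a))\<^sup>2 \<le> \<delta> * R\<^sup>2"
      using R(2)[OF z(1)] \<delta>(1) by (intro mult_left_mono power_mono) auto
    ultimately have "w z \<ge> - (\<delta> * R\<^sup>2)" by (simp add: w_def)
    then show False using \<open>w z \<le> f a\<close> \<delta>(2) by linarith
  qed
  then have zV: "z \<in> V"
    using z(1) V(1) by (simp add: frontier_def interior_open)
  obtain g m where g: "\<And>b. b \<in> Basis \<Longrightarrow>
          (\<forall>\<^sub>F t in nhds 0. ((\<lambda>t. f (z + t *\<^sub>R b)) has_real_derivative g b t) (at t)) \<and>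
          (g b has_real_derivative m b) (at 0)" and m: "(\<Sum>b\<in>Basis. m b) = 0"
    using harm[OF zV] unfolding harmonic_at_def by blast
  have "m b - 2 * \<delta> \<ge> 0" if b: "b \<in> Basis" for b
  proof (rule local_min_second_derivative_nonneg)
    note sq = norm_add_scaleR_Basis_sq[OF b]
    show "\<forall>\<^sub>F t in nhds 0. ((\<lambda>t. w (z + t *\<^sub>R b)) has_real_derivative
        g b t - \<delta> * (2 * ((z - a) \<bullet> b) + 2 * t)) (at t)"
      using g[OF b, THEN conjunct1]
    proof eventually_elim
      case (elim t)
      show ?case
          unfolding w_def sq by (auto intro!: derivative_eq_intros elim)
    qed
    show "((\<lambda>t. g b t - \<delta> * (2 * ((z - a) \<bullet> b) + 2 * t)) has_real_derivative
        m b - 2 * \<delta>) (at 0)"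
      using g[OF b, THEN conjunct2] by (auto intro!: derivative_eq_intros)
    have "((\<lambda>t::real. z + t *\<^sub>R b) \<longlongrightarrow> z + 0 *\<^sub>R b) (nhds 0)"
      by (intro tendsto_intros filterlim_ident)
    then have "\<forall>\<^sub>F t in nhds (0::real). z + t *\<^sub>R b \<in> V"
      using zV V(1) by (simp add: tendsto_def)
    then show "\<forall>\<^sub>F t in nhds 0. w (z + 0 *\<^sub>R b) \<le> w (z + t *\<^sub>R b)"
      by eventually_elim (use z(2) closure_subset in auto)
  qed
  then have "(\<Sum>b\<in>(Basis::'a set). m b - 2 * \<delta>) \<ge> 0" by (intro sum_nonneg)
  then have "2 * DIM('a) * \<delta> \<le> 0" using m by (simp add: sum_subtractf)
  then show False using \<delta>(1) DIM_positive[where 'a='a] by (simp add: mult_le_0_iff)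
qed

lemma comparison_principle:
  fixes f :: "'a::euclidean_space \<Rightarrow> real"
  assumes V: "open V" "bounded V"
    and cont: "continuous_on (closure V) f" "continuous_on (closure V) g"
    and harm: "\<And>x. x \<in> V \<Longrightarrow> harmonic_at f x" "\<And>x. x \<in> V \<Longrightarrow> harmonic_at g x"
    and bd: "\<And>x. x \<in> frontier V \<Longrightarrow> f x \<le> g x"
    and a: "a \<in> closure V"
  shows "f a \<le> g a"
  using minimum_principle[of V "\<lambda>x. g x - f x" a] assms
  by (auto intro: continuous_intros harmonic_at_diff)

lemma maximum_principle_abs:
  fixes f :: "'a::euclidean_space \<Rightarrow> real"
  assumes V: "open V" "bounded V"
    and cont: "continuous_on (closure V) f"
    and harm: "\<And>x. x \<in> V \<Longrightarrow> harmonic_at f x"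
    and bd: "\<And>x. x \<in> frontier V \<Longrightarrow> \<bar>f x\<bar> \<le> C"
    and a: "a \<in> closure V"
  shows "\<bar>f a\<bar> \<le> C"
proof -
  have "f x \<le> C \<and> - C \<le> f x" if "x \<in> frontier V" for x
    using bd[OF that] by linarith
  then have "f a \<le> C" "- C \<le> f a"
    using comparison_principle[of V f "\<lambda>_. C" a] comparison_principle[of V "\<lambda>_. - C" f a] assms
    by (auto intro: harmonic_at_const)
  then show ?thesis by simp
qed

section \<open>Second derivatives along lines and the Laplacian\<close>

lemma eventually_line_in:
  fixes x b :: "'a::real_normed_vector"
  assumes "open S" "x \<in> S"
  shows "\<forall>\<^sub>F t in nhds (0::real). x + t *\<^sub>R b \<in> S"
proof -
  have "((\<lambda>t::real. x + t *\<^sub>R b) \<longlongrightarrow> x + 0 *\<^sub>R b) (nhds 0)"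
    by (intro tendsto_intros filterlim_ident)
  then show ?thesis using assms by (simp add: tendsto_def)
qed

text \<open>\<open>laplacian\<close> iterates \<open>deriv\<close>, which carries information only
  where derivatives exist. The first derivative is available on an interval of each line, so the
  iterated \<open>deriv\<close> is the Hessian entry \<open>f'' b b\<close>.\<close>

lemma
  fixes u :: "'a::euclidean_space \<Rightarrow> real" and f' :: "'a \<Rightarrow> 'a \<Rightarrow>\<^sub>L real"
  assumes f': "\<And>x. x \<in> S \<Longrightarrow> (u has_derivative blinfun_apply (f' x)) (at x)"
    and f'': "(f' has_derivative blinfun_apply f'') (at x)"
    and S: "open S" "x \<in> S"
  shows line_derivative:
      "\<forall>\<^sub>F t in nhds 0. ((\<lambda>t. u (x + t *\<^sub>R b)) has_real_derivative f' (x + t *\<^sub>R b) b) (at t)"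
    and line_second_derivative:
      "((\<lambda>t. f' (x + t *\<^sub>R b) b) has_real_derivative f'' b b) (at 0)"
    and laplacian_eq_sum: "laplacian u x = (\<Sum>b\<in>Basis. f'' b b)"
proof -
  show A: "\<forall>\<^sub>F t in nhds 0. ((\<lambda>t. u (x + t *\<^sub>R b)) has_real_derivative f' (x + t *\<^sub>R b) b) (at t)"
    for b
    using eventually_line_in[OF S, of b]
  proof eventually_elim
    case (elim t)
    have "((\<lambda>t. u (x + t *\<^sub>R b)) has_derivative (\<lambda>s. f' (x + t *\<^sub>R b) (s *\<^sub>R b))) (at t)"
      by (rule has_derivative_compose[of "\<lambda>t. x + t *\<^sub>R b" "\<lambda>s. s *\<^sub>R b" t UNIV, OF _ f'[OF elim]])
        (auto intro!: derivative_eq_intros)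
    then show ?case
      by (rule has_derivative_imp_has_field_derivative) (simp add: blinfun.scaleR_right)
  qed
  show B: "((\<lambda>t. f' (x + t *\<^sub>R b) b) has_real_derivative f'' b b) (at 0)" for b
  proof -
    have "((\<lambda>t. f' (x + t *\<^sub>R b)) has_derivative (\<lambda>s. f'' (s *\<^sub>R b))) (at 0)"
      by (rule has_derivative_compose[of "\<lambda>t. x + t *\<^sub>R b" "\<lambda>s. s *\<^sub>R b" 0 UNIV])
        (auto intro!: derivative_eq_intros simp: f'')
    then have "((\<lambda>t. f' (x + t *\<^sub>R b) b) has_derivative (\<lambda>s. f'' (s *\<^sub>R b) b)) (at 0)"
      by (rule bounded_linear.has_derivative[OF blinfun.bounded_linear_left])
    then show ?thesis
      by (rule has_derivative_imp_has_field_derivative)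
        (simp add: blinfun.scaleR_right blinfun.scaleR_left)
  qed
  have "(deriv ^^ 2) (\<lambda>t. u (x + t *\<^sub>R b)) 0 = f'' b b" for b
  proof -
    have "\<forall>\<^sub>F t in nhds 0. deriv (\<lambda>t. u (x + t *\<^sub>R b)) t = f' (x + t *\<^sub>R b) b"
      using A[of b] by eventually_elim (rule DERIV_imp_deriv)
    then have "deriv (deriv (\<lambda>t. u (x + t *\<^sub>R b))) 0 = deriv (\<lambda>t. f' (x + t *\<^sub>R b) b) 0"
      by (rule deriv_cong_ev) simp
    then show ?thesis using DERIV_imp_deriv[OF B] by (simp add: numeral_2_eq_2)
  qed
  then show "laplacian u x = (\<Sum>b\<in>Basis. f'' b b)"
    by (simp add: laplacian_def)
qed

lemma harmonic_at_of_C2_laplacian: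
  fixes u :: "'a::euclidean_space \<Rightarrow> real"
  assumes "C2_on u S" "open S" "x \<in> S" "laplacian u x = 0"
  shows "harmonic_at u x"
proof -
  obtain f' :: "'a \<Rightarrow> 'a \<Rightarrow>\<^sub>L real" and f'' where
    f': "\<And>x. x \<in> S \<Longrightarrow> (u has_derivative blinfun_apply (f' x)) (at x)" and
    f'': "\<And>x. x \<in> S \<Longrightarrow> (f' has_derivative blinfun_apply (f'' x)) (at x)"
    using assms(1) unfolding C2_on_def by blast
  note line = line_derivative[OF f' f''] line_second_derivative[OF f' f''] laplacian_eq_sum[OF f' f'']
  show ?thesis
    unfolding harmonic_at_def
    by (intro exI[of _ "\<lambda>b t. f' (x + t *\<^sub>R b) b"] exI[of _ "\<lambda>b. f'' x b b"])
      (use line assms(2-4) in auto)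
qed

subsection \<open>Gradient bounds through holomorphic functions\<close>

text \<open>The mean value theorem is applied in \<open>s\<close> to the first difference
  \<open>g\<close>; differentiability of \<open>f'\<close> at the single point \<open>x\<close> then
  estimates the slope.\<close>

lemma second_difference_quotient:
  fixes f :: "'a::real_normed_vector \<Rightarrow> real" and f' :: "'a \<Rightarrow> 'a \<Rightarrow>\<^sub>L real"
  assumes S: "open S" "x \<in> S"
    and f': "\<And>z. z \<in> S \<Longrightarrow> (f has_derivative blinfun_apply (f' z)) (at z)"
    and D: "(f' has_derivative D) (at x)"
    and "e > 0"
  shows "\<exists>r>0. \<forall>t. 0 < t \<and> t < r \<longrightarrow>
    \<bar>f (x + t *\<^sub>R u + t *\<^sub>R v) - f (x + t *\<^sub>R u) - f (x + t *\<^sub>R v) + f x - t\<^sup>2 * D v u\<bar> \<le> e * t\<^sup>2"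
proof -
  define M where "M = norm u + norm v + 1"
  have M: "M > 0" "norm u \<le> M" "norm u + norm v \<le> M" by (auto simp: M_def add_nonneg_pos)
  interpret D: bounded_linear D using D by (rule has_derivative_bounded_linear)
  \<comment> \<open>In \<open>e / (2 * M\<^sup>2)\<close> one factor \<open>M\<close> pays for the
    displacement \<open>t * M\<close>, the other for evaluating at \<open>u\<close>; the 2 splits
    \<open>e\<close> over the remainders \<open>r1\<close> and \<open>r2\<close>.\<close>
  obtain \<delta> where \<delta>: "\<delta> > 0"
    "\<And>z. norm (z - x) < \<delta> \<Longrightarrow> norm (f' z - f' x - D (z - x)) \<le> e / (2 * M\<^sup>2) * norm (z - x)"
    using D \<open>e > 0\<close> M(1) unfolding has_derivative_at_alt
    by (metis divide_pos_pos mult_pos_pos zero_less_numeral zero_less_power)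
  obtain \<delta>' where \<delta>': "\<delta>' > 0" "ball x \<delta>' \<subseteq> S" using S openE by blast
  show ?thesis
  proof (intro exI[of _ "min \<delta> \<delta>' / M"] conjI allI impI)
    show "min \<delta> \<delta>' / M > 0" using \<delta> \<delta>' M by simp
    fix t assume t: "0 < t \<and> t < min \<delta> \<delta>' / M"
    then have tM: "t * M < \<delta>" "t * M < \<delta>'" using M(1) by (auto simp: pos_less_divide_eq)
    have bd: "norm (s *\<^sub>R u + r *\<^sub>R v) \<le> t * M" if "0 \<le> s" "s \<le> t" "0 \<le> r" "r \<le> t" for s r
    proof -
      have "norm (s *\<^sub>R u + r *\<^sub>R v) \<le> s * norm u + r * norm v"
        using norm_triangle_ineq[of "s *\<^sub>R u" "r *\<^sub>R v"] that by simp
      also have "\<dots> \<le> t * norm u + t * norm v"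
        using that by (intro add_mono mult_right_mono) auto
      also have "\<dots> \<le> t * M" using M(3) t by (simp add: distrib_left[symmetric])
      finally show ?thesis .
    qed
    have inS: "x + s *\<^sub>R u + r *\<^sub>R v \<in> S" if "0 \<le> s" "s \<le> t" "0 \<le> r" "r \<le> t" for s r
    proof -
      have "norm (s *\<^sub>R u + r *\<^sub>R v) < \<delta>'" using bd[OF that] tM by simp
      then have "x + s *\<^sub>R u + r *\<^sub>R v \<in> ball x \<delta>'"
        using norm_minus_cancel[of "s *\<^sub>R u + r *\<^sub>R v"] by (simp add: add.assoc dist_norm)
      then show ?thesis using \<delta>'(2) by blast
    qed
    have rem: "\<bar>f' (x + s *\<^sub>R u + r *\<^sub>R v) u - f' x u - D (s *\<^sub>R u + r *\<^sub>R v) u\<bar> \<le> e / 2 * t"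
      if "0 \<le> s" "s \<le> t" "0 \<le> r" "r \<le> t" for s r
    proof -
      let ?h = "s *\<^sub>R u + r *\<^sub>R v"
      have "norm (f' (x + ?h) - f' x - D ?h) \<le> e / (2 * M\<^sup>2) * norm ?h"
        using \<delta>(2)[of "x + ?h"] bd[OF that] tM(1) by simp
      also have "\<dots> \<le> e / (2 * M\<^sup>2) * (t * M)"
        using bd[OF that] \<open>e > 0\<close> by (intro mult_left_mono) auto
      finally have n: "norm (f' (x + ?h) - f' x - D ?h) \<le> e / (2 * M\<^sup>2) * (t * M)" .
      have "\<bar>(f' (x + ?h) - f' x - D ?h) u\<bar> \<le> norm (f' (x + ?h) - f' x - D ?h) * norm u"
        using norm_blinfun[of "f' (x + ?h) - f' x - D ?h" u] by simp
      also have "\<dots> \<le> e / (2 * M\<^sup>2) * (t * M) * M"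
        using n M \<open>e > 0\<close> t by (intro mult_mono) auto
      also have "\<dots> = e / 2 * t" using M(1) by (simp add: power2_eq_square)
      finally show ?thesis by (simp add: blinfun.diff_left add.assoc)
    qed
    define g where "g s = f (x + s *\<^sub>R u + t *\<^sub>R v) - f (x + s *\<^sub>R u)" for s
    have dg: "(g has_real_derivative f' (x + s *\<^sub>R u + t *\<^sub>R v) u - f' (x + s *\<^sub>R u) u) (at s)"
      if "0 \<le> s" "s \<le> t" for s
    proof -
      have "(g has_derivative (\<lambda>r. f' (x + s *\<^sub>R u + t *\<^sub>R v) (r *\<^sub>R u) - f' (x + s *\<^sub>R u) (r *\<^sub>R u))) (at s)"
        unfolding g_def
      proof (rule has_derivative_diff)
        show "((\<lambda>s. f (x + s *\<^sub>R u + t *\<^sub>R v)) has_derivative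
            (\<lambda>r. f' (x + s *\<^sub>R u + t *\<^sub>R v) (r *\<^sub>R u))) (at s)"
          by (rule has_derivative_compose[of "\<lambda>s. x + s *\<^sub>R u + t *\<^sub>R v" "\<lambda>r. r *\<^sub>R u" s UNIV,
                OF _ f'[OF inS[of s t]]])
            (use that t in \<open>auto intro!: derivative_eq_intros\<close>)
        show "((\<lambda>s. f (x + s *\<^sub>R u)) has_derivative (\<lambda>r. f' (x + s *\<^sub>R u) (r *\<^sub>R u))) (at s)"
          by (rule has_derivative_compose[of "\<lambda>s. x + s *\<^sub>R u" "\<lambda>r. r *\<^sub>R u" s UNIV, OF _ f'])
            (use inS[of s 0] that t in \<open>auto intro!: derivative_eq_intros\<close>)
      qed
      then show ?thesis
        by (rule has_derivative_imp_has_field_derivative)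
          (simp add: blinfun.scaleR_right right_diff_distrib mult.commute)
    qed
    obtain s where s: "0 < s" "s < t"
      "g t - g 0 = (t - 0) * (f' (x + s *\<^sub>R u + t *\<^sub>R v) u - f' (x + s *\<^sub>R u) u)"
      using MVT2[of 0 t g, OF _ dg] t by blast
    have lin: "D (s *\<^sub>R u + t *\<^sub>R v) u - D (s *\<^sub>R u) u = t * D v u"
      by (simp add: D.add D.scaleR blinfun.add_left blinfun.scaleR_left)
    have r1: "\<bar>f' (x + s *\<^sub>R u + t *\<^sub>R v) u - f' x u - D (s *\<^sub>R u + t *\<^sub>R v) u\<bar> \<le> e / 2 * t"
      by (rule rem) (use s t in auto)
    have r2: "\<bar>f' (x + s *\<^sub>R u) u - f' x u - D (s *\<^sub>R u) u\<bar> \<le> e / 2 * t"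
      using rem[of s 0] s t by simp
    have "\<bar>(f' (x + s *\<^sub>R u + t *\<^sub>R v) u - f' (x + s *\<^sub>R u) u) - t * D v u\<bar> \<le> e / 2 * t + e / 2 * t"
      using r1 r2 unfolding lin[symmetric] by linarith
    also have "\<dots> = e * t" by simp
    finally have "\<bar>(f' (x + s *\<^sub>R u + t *\<^sub>R v) u - f' (x + s *\<^sub>R u) u) - t * D v u\<bar> \<le> e * t" .
    then have "t * \<bar>(f' (x + s *\<^sub>R u + t *\<^sub>R v) u - f' (x + s *\<^sub>R u) u) - t * D v u\<bar> \<le> t * (e * t)"
      using t by (intro mult_left_mono) auto
    then have "\<bar>t * ((f' (x + s *\<^sub>R u + t *\<^sub>R v) u - f' (x + s *\<^sub>R u) u) - t * D v u)\<bar> \<le> e * t\<^sup>2"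
      using t unfolding abs_mult by (simp add: power2_eq_square mult.left_commute)
    moreover have "f (x + t *\<^sub>R u + t *\<^sub>R v) - f (x + t *\<^sub>R u) - f (x + t *\<^sub>R v) + f x - t\<^sup>2 * D v u
        = t * ((f' (x + s *\<^sub>R u + t *\<^sub>R v) u - f' (x + s *\<^sub>R u) u) - t * D v u)"
      using s(3) by (simp add: g_def power2_eq_square algebra_simps)
    ultimately show "\<bar>f (x + t *\<^sub>R u + t *\<^sub>R v) - f (x + t *\<^sub>R u) - f (x + t *\<^sub>R v) + f x
        - t\<^sup>2 * D v u\<bar> \<le> e * t\<^sup>2" by simp
  qed
qed

text \<open>The second difference is unchanged when \<open>u\<close> and \<open>v\<close> are
  exchanged, while divided by \<open>t\<^sup>2\<close> it approaches \<open>D v u\<close> in one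
  order and \<open>D u v\<close> in the other.\<close>

lemma second_derivative_symmetric:
  fixes f :: "'a::real_normed_vector \<Rightarrow> real" and f' :: "'a \<Rightarrow> 'a \<Rightarrow>\<^sub>L real"
  assumes S: "open S" "x \<in> S"
    and f': "\<And>z. z \<in> S \<Longrightarrow> (f has_derivative blinfun_apply (f' z)) (at z)"
    and D: "(f' has_derivative D) (at x)"
  shows "D u v = D v u"
proof -
  have "\<bar>D u v - D v u\<bar> \<le> e" if "e > 0" for e
  proof -
    obtain r1 where r1: "r1 > 0" "\<And>t. 0 < t \<and> t < r1 \<Longrightarrow>
       \<bar>f (x + t *\<^sub>R u + t *\<^sub>R v) - f (x + t *\<^sub>R u) - f (x + t *\<^sub>R v) + f x - t\<^sup>2 * D v u\<bar> \<le> e/2 * t\<^sup>2"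
      using second_difference_quotient[OF S f' D half_gt_zero[OF \<open>e > 0\<close>], of u v] by blast
    obtain r2 where r2: "r2 > 0" "\<And>t. 0 < t \<and> t < r2 \<Longrightarrow>
       \<bar>f (x + t *\<^sub>R v + t *\<^sub>R u) - f (x + t *\<^sub>R v) - f (x + t *\<^sub>R u) + f x - t\<^sup>2 * D u v\<bar> \<le> e/2 * t\<^sup>2"
      using second_difference_quotient[OF S f' D half_gt_zero[OF \<open>e > 0\<close>], of v u] by blast
    define t where "t = min r1 r2 / 2"
    have t: "0 < t" "t < r1" "t < r2" using r1 r2 by (auto simp: t_def)
    have comm: "x + t *\<^sub>R v + t *\<^sub>R u = x + t *\<^sub>R u + t *\<^sub>R v" by simp
    have "\<bar>t\<^sup>2 * D u v - t\<^sup>2 * D v u\<bar> \<le> e / 2 * t\<^sup>2 + e / 2 * t\<^sup>2"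
      using r1(2)[of t] r2(2)[of t] t unfolding comm by linarith
    then have "\<bar>t\<^sup>2 * D u v - t\<^sup>2 * D v u\<bar> \<le> e * t\<^sup>2" by simp
    then have "\<bar>t\<^sup>2 * (D u v - D v u)\<bar> \<le> e * t\<^sup>2" unfolding right_diff_distrib .
    then have "t\<^sup>2 * \<bar>D u v - D v u\<bar> \<le> t\<^sup>2 * e"
      unfolding abs_mult by (simp add: mult.commute)
    then show ?thesis using t by simp
  qed
  then have "\<bar>D u v - D v u\<bar> \<le> 0" by (meson dense_ge)
  then show ?thesis by simp
qed

section \<open>Plane harmonic functions on a disk as real parts\<close>

lemma norm_Basis_pair:
  fixes e1 e2 :: "'a::euclidean_space"
  assumes B: "Basis = {e1, e2}" "e1 \<noteq> e2"
  shows "norm (Re z *\<^sub>R e1 + Im z *\<^sub>R e2) = cmod z"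
proof -
  have e: "e1 \<in> Basis" "e2 \<in> Basis" unfolding B(1) by auto
  then have "e1 \<bullet> e1 = 1" "e2 \<bullet> e2 = 1" "e1 \<bullet> e2 = 0" "e2 \<bullet> e1 = 0"
    using B(2) by (auto simp: inner_same_Basis inner_not_same_Basis)
  then show ?thesis
    unfolding norm_eq_sqrt_inner[where 'a='a] cmod_def
    by (simp add: inner_add_left inner_add_right power2_eq_square)
qed

text \<open>The function \<open>f\<close>, classically u_x - i u_y, satisfies the Cauchy-Riemann
  equations: one is the vanishing Laplacian, the other the symmetry of the second derivative. The
  real part of a primitive has the same gradient as \<open>u\<close>, and a constant is
  subtracted.\<close>

lemma harmonic_eq_Re_holomorphic:
  fixes u :: "'a::euclidean_space \<Rightarrow> real"
  assumes B: "Basis = {e1, e2 :: 'a}" "e1 \<noteq> e2"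
    and C2: "C2_on u (ball x d)"
    and lap: "\<And>z. z \<in> ball x d \<Longrightarrow> laplacian u z = 0"
  obtains F where "F holomorphic_on ball 0 d"
    and "\<And>z. z \<in> ball 0 d \<Longrightarrow> Re (F z) = u (x + (Re z *\<^sub>R e1 + Im z *\<^sub>R e2))"
proof -
  obtain f' :: "'a \<Rightarrow> 'a \<Rightarrow>\<^sub>L real" and f'' where
    f': "\<And>z. z \<in> ball x d \<Longrightarrow> (u has_derivative blinfun_apply (f' z)) (at z)" and
    f'': "\<And>z. z \<in> ball x d \<Longrightarrow> (f' has_derivative blinfun_apply (f'' z)) (at z)"
    using C2 unfolding C2_on_def by blast
  define \<iota> where "\<iota> z = Re z *\<^sub>R e1 + Im z *\<^sub>R e2" for z
  have n\<iota>: "norm (\<iota> z) = cmod z" for z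
    unfolding \<iota>_def by (rule norm_Basis_pair[OF B])
  have \<iota>b: "x + \<iota> z \<in> ball x d" if "z \<in> ball 0 d" for z
    using that by (simp add: dist_norm n\<iota>)
  have \<iota>d: "((\<lambda>z. x + \<iota> z) has_derivative \<iota>) (at z)" for z
    unfolding \<iota>_def by (auto intro!: derivative_eq_intros)
  define f where "f z = complex_of_real (f' (x + \<iota> z) e1) - \<i> * complex_of_real (f' (x + \<iota> z) e2)" for z
  have fd: "(f has_field_derivative Complex (f'' (x + \<iota> z) e1 e1) (- f'' (x + \<iota> z) e1 e2)) (at z)"
    if z: "z \<in> ball 0 d" for z
  proof -
    let ?D = "f'' (x + \<iota> z)"
    have c: "((\<lambda>z. f' (x + \<iota> z)) has_derivative (\<lambda>v. ?D (\<iota> v))) (at z)"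
      by (rule has_derivative_compose[OF \<iota>d f''[OF \<iota>b[OF z]]])
    have c': "((\<lambda>z. f' (x + \<iota> z) e) has_derivative (\<lambda>v. ?D (\<iota> v) e)) (at z)" for e
      by (rule bounded_linear.has_derivative[OF blinfun.bounded_linear_left c])
    have sym: "?D e1 e2 = ?D e2 e1"
      by (rule second_derivative_symmetric[OF open_ball \<iota>b[OF z] f' f''[OF \<iota>b[OF z]]])
    have "?D e1 e1 + ?D e2 e2 = 0"
      using laplacian_eq_sum[OF f' f''[OF \<iota>b[OF z]] open_ball \<iota>b[OF z]] lap[OF \<iota>b[OF z]] B(2)
      unfolding B(1) by simp
    then have lap': "?D e2 e2 = - ?D e1 e1" by linarith
    have "?D (\<iota> v) e = Re v * ?D e1 e + Im v * ?D e2 e" for v e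
      by (simp add: \<iota>_def blinfun.add_right blinfun.scaleR_right blinfun.add_left blinfun.scaleR_left)
    then have "(\<lambda>v. complex_of_real (?D (\<iota> v) e1) - \<i> * complex_of_real (?D (\<iota> v) e2)) =
        (*) (Complex (?D e1 e1) (- ?D e1 e2))"
      by (auto simp: fun_eq_iff complex_eq_iff sym lap' algebra_simps)
    moreover have "(f has_derivative
        (\<lambda>v. complex_of_real (?D (\<iota> v) e1) - \<i> * complex_of_real (?D (\<iota> v) e2))) (at z)"
      unfolding f_def by (auto intro!: derivative_eq_intros c)
    ultimately show ?thesis by (simp add: has_field_derivative_def)
  qed
  then have "f holomorphic_on ball 0 d"
    unfolding holomorphic_on_def field_differentiable_def
    by (intro ballI exI) (rule has_field_derivative_at_within)
  then obtain G where G: "\<And>z. z \<in> ball 0 d \<Longrightarrow> (G has_field_derivative f z) (at z within ball 0 d)"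
    using holomorphic_convex_primitive'[OF convex_ball open_ball] by blast
  have G': "(G has_field_derivative f z) (at z)" if "z \<in> ball 0 d" for z
    using G[OF that] that by (simp add: at_within_open[OF that open_ball])
  have "\<exists>c. \<forall>z\<in>ball 0 d. Re (G z) - u (x + \<iota> z) = c"
  proof (rule has_derivative_zero_constant[OF convex_ball])
    fix z :: complex assume z: "z \<in> ball 0 d"
    have 1: "((\<lambda>z. Re (G z)) has_derivative (\<lambda>v. Re (f z * v))) (at z)"
      using G'[OF z] by (auto intro!: derivative_eq_intros simp: has_field_derivative_def)
    have 2: "((\<lambda>z. u (x + \<iota> z)) has_derivative (\<lambda>v. f' (x + \<iota> z) (\<iota> v))) (at z)"
      by (rule has_derivative_compose[OF \<iota>d f'[OF \<iota>b[OF z]]])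
    have "Re (f z * v) = f' (x + \<iota> z) (\<iota> v)" for v
      by (simp add: f_def \<iota>_def blinfun.add_right blinfun.scaleR_right)
    with has_derivative_diff[OF 1 2]
    have "((\<lambda>z. Re (G z) - u (x + \<iota> z)) has_derivative (\<lambda>v. 0)) (at z)" by simp
    then show "((\<lambda>z. Re (G z) - u (x + \<iota> z)) has_derivative (\<lambda>v. 0)) (at z within ball 0 d)"
      by (rule has_derivative_at_withinI)
  qed
  then obtain c where c: "\<And>z. z \<in> ball 0 d \<Longrightarrow> Re (G z) - u (x + \<iota> z) = c" by blast
  show ?thesis
  proof (rule that[of "\<lambda>z. G z - of_real c"])
    have "G holomorphic_on ball 0 d"
      unfolding holomorphic_on_def field_differentiable_def using G by blast
    then show "(\<lambda>z. G z - of_real c) holomorphic_on ball 0 d"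
      by (intro holomorphic_intros)
    show "Re (G z - of_real c) = u (x + (Re z *\<^sub>R e1 + Im z *\<^sub>R e2))" if "z \<in> ball 0 d" for z
      using c[OF that] by (simp add: \<iota>_def)
  qed
qed

text \<open>The Cayley transform \<open>g\<close> takes values in the unit disk, so Cauchy's
  inequality bounds its derivative by \<open>1 / r\<close>; the transform has derivative 1 / (2 a)
  at \<open>a\<close>, whence the factor 2.\<close>

lemma holomorphic_Re_nonneg_deriv_bound:
  assumes hol: "F holomorphic_on ball 0 d" and "d > 0"
    and pos: "\<And>z. z \<in> ball 0 d \<Longrightarrow> 0 \<le> Re (F z)"
  shows "cmod (deriv F 0) \<le> 2 * Re (F 0) / d"
proof -
  have step: "cmod (deriv F 0) * r \<le> 2 * (Re (F 0) + e)" if "0 < r" "r < d" "e > 0" for r e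
  proof -
    \<comment> \<open>Adding \<open>e\<close> makes the real part strictly positive, so the
      denominator of \<open>g\<close> cannot vanish; removing the imaginary part makes
      \<open>G 0\<close> equal to \<open>a\<close>, the zero of the transform. Afterwards
      \<open>e\<close> tends to 0 and \<open>r\<close> to \<open>d\<close>.\<close>
    define a where "a = Re (F 0) + e"
    have a: "a > 0" using pos[of 0] \<open>d > 0\<close> \<open>e > 0\<close> by (simp add: a_def add_nonneg_pos)
    define G where "G z = F z - \<i> * of_real (Im (F 0)) + of_real e" for z
    have G0: "G 0 = of_real a" by (simp add: G_def a_def complex_eq_iff)
    have ReG: "Re (G z) > 0" if "z \<in> ball 0 d" for z
      using pos[OF that] \<open>e > 0\<close> by (simp add: G_def)
    then have nz: "G z + of_real a \<noteq> 0" if "z \<in> ball 0 d" for z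
      using a that by (metis Re_complex_of_real add_pos_pos less_irrefl plus_complex.sel(1) zero_complex.sel(1))
    define g where "g z = (G z - of_real a) / (G z + of_real a)" for z
    have holG: "G holomorphic_on ball 0 d" unfolding G_def by (intro holomorphic_intros hol)
    have holg: "g holomorphic_on ball 0 d"
      unfolding g_def by (intro holomorphic_intros holG) (use nz in auto)
    have g1: "cmod (g z) \<le> 1" if "z \<in> ball 0 d" for z
    proof -
      have "(cmod (G z - of_real a))\<^sup>2 \<le> (cmod (G z + of_real a))\<^sup>2"
        using ReG[OF that] a by (simp only: cmod_power2) (simp add: power2_eq_square algebra_simps)
      then have "cmod (G z - of_real a) \<le> cmod (G z + of_real a)"
        by (rule power2_le_imp_le) simp
      then show ?thesis using nz[OF that] by (simp add: g_def norm_divide)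
    qed
    have sub: "cball 0 r \<subseteq> ball (0::complex) d" using that by auto
    have "cmod ((deriv ^^ 1) g 0) \<le> fact 1 * 1 / r ^ 1"
    proof (rule Cauchy_inequality)
      show "g holomorphic_on ball 0 r"
        using holg sub ball_subset_cball holomorphic_on_subset by blast
      show "continuous_on (cball 0 r) g"
        using holg sub holomorphic_on_imp_continuous_on continuous_on_subset by blast
    qed (use that g1 sub in auto)
    then have g': "cmod (deriv g 0) \<le> 1 / r" by simp
    have dF: "(F has_field_derivative deriv F 0) (at 0)"
      using hol \<open>d > 0\<close> by (intro holomorphic_derivI[of F "ball 0 d"]) auto
    have dG: "(G has_field_derivative deriv F 0) (at 0)"
      unfolding G_def by (auto intro!: derivative_eq_intros dF)
    have "(g has_field_derivative (deriv F 0 * (G 0 + of_real a) - (G 0 - of_real a) * deriv F 0)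
            / ((G 0 + of_real a) * (G 0 + of_real a))) (at 0)"
      unfolding g_def
      by (rule DERIV_divide) (use nz[of 0] \<open>d > 0\<close> in \<open>auto intro!: derivative_eq_intros dG\<close>)
    then have "deriv g 0 = deriv F 0 / (2 * of_real a)"
      using a by (simp add: DERIV_imp_deriv G0 field_simps)
    then have "cmod (deriv F 0) = 2 * a * cmod (deriv g 0)"
      using a by (simp add: norm_divide norm_mult)
    also have "\<dots> \<le> 2 * a * (1 / r)" using g' a by (intro mult_left_mono) auto
    finally show ?thesis using that by (simp add: a_def field_simps)
  qed
  have "cmod (deriv F 0) * r \<le> 2 * Re (F 0)" if "0 < r" "r < d" for r
  proof (rule field_le_epsilon)
    fix e :: real assume "e > 0"
    then show "cmod (deriv F 0) * r \<le> 2 * Re (F 0) + e" using step[OF that, of "e/2"] by simp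
  qed
  then have "cmod (deriv F 0) * d \<le> 2 * Re (F 0)"
  proof -
    assume *: "\<And>r. 0 < r \<Longrightarrow> r < d \<Longrightarrow> cmod (deriv F 0) * r \<le> 2 * Re (F 0)"
    have "((\<lambda>r. cmod (deriv F 0) * r) \<longlongrightarrow> cmod (deriv F 0) * d) (at_left d)"
      by (intro tendsto_intros)
    moreover have "\<forall>\<^sub>F r in at_left d. cmod (deriv F 0) * r \<le> 2 * Re (F 0)"
      using eventually_at_left_real[OF \<open>d > 0\<close>] by eventually_elim (use * in auto)
    ultimately show ?thesis by (rule tendsto_upperbound) simp
  qed
  then show ?thesis using \<open>d > 0\<close> by (simp add: field_simps)
qed

text \<open>Serves the comparison function in its first variable. On a disk that avoids
  \<open>p\<close> the logarithm is the real part of a holomorphic branch of log (z - p), so its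
  second derivatives never have to be computed.\<close>

lemma positive_log_minus_harmonic_gradient:
  fixes k :: "'a::euclidean_space \<Rightarrow> real"
  assumes dim: "DIM('a) = 2" and "d > 0"
    and C2: "C2_on k (ball x d)"
    and lap: "\<And>z. z \<in> ball x d \<Longrightarrow> laplacian k z = 0"
    and p: "p \<notin> ball x d"
    and pos: "\<And>z. z \<in> ball x d \<Longrightarrow> 0 \<le> A + B * ln (norm (z - p)) - k z"
    and D: "((\<lambda>z. A + B * ln (norm (z - p)) - k z) has_derivative D) (at x)"
  shows "\<bar>D v\<bar> \<le> 2 * (A + B * ln (norm (x - p)) - k x) / d * norm v"
proof -
  obtain e1 e2 :: 'a where B: "Basis = {e1, e2}" "e1 \<noteq> e2"
    using dim by (meson card_2_iff)
  define \<iota> where "\<iota> z = Re z *\<^sub>R e1 + Im z *\<^sub>R e2" for z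
  define \<kappa> where "\<kappa> w = Complex (w \<bullet> e1) (w \<bullet> e2)" for w
  have n\<iota>: "norm (\<iota> z) = cmod z" for z
    unfolding \<iota>_def by (rule norm_Basis_pair[OF B])
  have \<iota>\<kappa>: "\<iota> (\<kappa> w) = w" for w
    using euclidean_representation[of w] B(2) unfolding B(1) by (simp add: \<iota>_def \<kappa>_def)
  have \<iota>diff: "\<iota> (z - w) = \<iota> z - \<iota> w" for z w
    by (simp add: \<iota>_def algebra_simps)
  have \<iota>b: "x + \<iota> z \<in> ball x d" if "z \<in> ball 0 d" for z
    using that by (simp add: dist_norm n\<iota>)
  define q where "q = \<kappa> (p - x)"
  have nq: "norm (x + \<iota> z - p) = cmod (z - q)" for z
  proof -
    have "x + \<iota> z - p = \<iota> (z - q)" by (simp add: \<iota>diff q_def \<iota>\<kappa>)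
    then show ?thesis by (simp add: n\<iota>)
  qed
  have q: "z - q \<noteq> 0" if "z \<in> ball 0 d" for z
  proof
    assume "z - q = 0"
    then have "x + \<iota> z = p" using nq[of z] by simp
    then show False using \<iota>b[OF that] p by simp
  qed
  obtain L where L: "L holomorphic_on ball 0 d" "\<And>z. z \<in> ball 0 d \<Longrightarrow> z - q = exp (L z)"
  proof (rule contractible_imp_holomorphic_log[of "\<lambda>z. z - q" "ball 0 d"])
    show "(\<lambda>z. z - q) holomorphic_on ball 0 d" by (intro holomorphic_intros)
    show "contractible (ball (0::complex) d)" by (rule convex_imp_contractible) simp
  qed (use q in auto)
  obtain F where F: "F holomorphic_on ball 0 d"
    "\<And>z. z \<in> ball 0 d \<Longrightarrow> Re (F z) = k (x + (Re z *\<^sub>R e1 + Im z *\<^sub>R e2))"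
    using harmonic_eq_Re_holomorphic[OF B C2 lap] by blast
  define H where "H z = of_real A + of_real B * L z - F z" for z
  have holH: "H holomorphic_on ball 0 d" unfolding H_def by (intro holomorphic_intros L F)
  have ReH: "Re (H z) = A + B * ln (norm (x + \<iota> z - p)) - k (x + \<iota> z)" if "z \<in> ball 0 d" for z
  proof -
    have "ln (cmod (z - q)) = Re (L z)" using L(2)[OF that] by simp
    then show ?thesis using F(2)[OF that, folded \<iota>_def] by (simp add: H_def nq)
  qed
  have bound: "cmod (deriv H 0) \<le> 2 * Re (H 0) / d"
    using holH \<open>d > 0\<close> by (rule holomorphic_Re_nonneg_deriv_bound) (use ReH pos \<iota>b in auto)
  have \<iota>0: "\<iota> 0 = 0" by (simp add: \<iota>_def)
  have dH: "(H has_field_derivative deriv H 0) (at 0)"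
    using holH \<open>d > 0\<close> by (intro holomorphic_derivI[of H "ball 0 d"]) auto
  have "((\<lambda>z. Re (H z)) has_derivative (\<lambda>v. Re (deriv H 0 * v))) (at 0)"
    using dH by (auto intro!: derivative_eq_intros simp: has_field_derivative_def)
  then have 1: "((\<lambda>z. A + B * ln (norm (x + \<iota> z - p)) - k (x + \<iota> z)) has_derivative
      (\<lambda>v. Re (deriv H 0 * v))) (at 0)"
    by (rule has_derivative_transform_within[of _ _ _ _ d]) (use ReH \<open>d > 0\<close> in \<open>auto simp: dist_norm\<close>)
  have \<iota>d: "((\<lambda>z. x + \<iota> z) has_derivative \<iota>) (at 0)"
    unfolding \<iota>_def by (auto intro!: derivative_eq_intros)
  have "((\<lambda>z. A + B * ln (norm (x + \<iota> z - p)) - k (x + \<iota> z)) has_derivative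
      (\<lambda>v. D (\<iota> v))) (at 0)"
    by (rule has_derivative_compose[OF \<iota>d]) (use D in \<open>simp add: \<iota>0\<close>)
  from has_derivative_unique[OF this 1] have "D (\<iota> (\<kappa> v)) = Re (deriv H 0 * \<kappa> v)"
    by (rule fun_cong)
  then have "\<bar>D v\<bar> \<le> cmod (deriv H 0) * cmod (\<kappa> v)"
    using abs_Re_le_cmod[of "deriv H 0 * \<kappa> v"] by (simp add: \<iota>\<kappa> norm_mult)
  also have "cmod (\<kappa> v) = norm v" using n\<iota>[of "\<kappa> v"] by (simp add: \<iota>\<kappa>)
  also have "cmod (deriv H 0) * norm v \<le> 2 * Re (H 0) / d * norm v"
    using bound by (rule mult_right_mono) simp
  finally show ?thesis using ReH[of 0] \<open>d > 0\<close> by (simp add: \<iota>0)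
qed

subsection \<open>The kernel of a disk\<close>

text \<open>The regular part of the Green function of a disk of radius \<open>r\<close> about \<open>c\<close>, by the method of
  images. The formula is meaningful when \<open>x\<close> and \<open>y\<close> are both inside or both outside the disk, and
  it is symmetric. At \<open>x = reflection_point c r y\<close> it has the junk value \<open>ln 0 = 0\<close>.\<close>
definition disk_kernel :: "'a::real_inner \<Rightarrow> real \<Rightarrow> 'a \<Rightarrow> 'a \<Rightarrow> real" where
  "disk_kernel c r x y = 1 / (4 * pi) *
     ln ((r\<^sup>2 * (norm (x - y))\<^sup>2 + ((norm (x - c))\<^sup>2 - r\<^sup>2) * ((norm (y - c))\<^sup>2 - r\<^sup>2)) / r\<^sup>2)"

text \<open>Inversion of \<open>y\<close> in the circle, the position of the image pole. For
  \<open>y = c\<close> division by zero makes it \<open>c\<close>, so this case is excluded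
  below.\<close>

definition reflection_point :: "'a::real_inner \<Rightarrow> real \<Rightarrow> 'a \<Rightarrow> 'a" where
  "reflection_point c r y = c + (r\<^sup>2 / (norm (y - c))\<^sup>2) *\<^sub>R (y - c)"

lemma disk_kernel_commute: "disk_kernel c r x y = disk_kernel c r y x"
  by (simp add: disk_kernel_def norm_minus_commute mult.commute)

text \<open>On the diagonal the argument of the logarithm is a perfect square, which turns 1 / (4
  pi) into 1 / (2 pi); the absolute value serves points inside and outside the disk alike.\<close>

lemma disk_kernel_diag:
  assumes "r > 0" "norm (y - c) \<noteq> r"
  shows "disk_kernel c r y y = 1 / (2 * pi) * ln (\<bar>(norm (y - c))\<^sup>2 - r\<^sup>2\<bar> / r)"
proof -
  have "(norm (y - c))\<^sup>2 \<noteq> r\<^sup>2" using assms by (simp add: power2_eq_iff_nonneg)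
  then have "ln ((\<bar>(norm (y - c))\<^sup>2 - r\<^sup>2\<bar> / r)\<^sup>2) = 2 * ln (\<bar>(norm (y - c))\<^sup>2 - r\<^sup>2\<bar> / r)"
    using assms by (subst ln_realpow) auto
  then show ?thesis by (simp add: disk_kernel_def power_divide power2_eq_square)
qed

text \<open>Links the symmetric formula of \<open>disk_kernel\<close> to image charges: up to a
  factor depending on \<open>y\<close>, it is the squared distance from \<open>x\<close> to the
  image pole that stands under the logarithm.\<close>

lemma reflection_point_identity:
  assumes "y \<noteq> c"
  shows "r\<^sup>2 * (norm (x - y))\<^sup>2 + ((norm (x - c))\<^sup>2 - r\<^sup>2) * ((norm (y - c))\<^sup>2 - r\<^sup>2)
    = (norm (y - c))\<^sup>2 * (norm (x - reflection_point c r y))\<^sup>2"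
proof -
  define X Y where "X = x - c" and "Y = y - c"
  define q where "q = r\<^sup>2 / (norm Y)\<^sup>2"
  have q: "q * (norm Y)\<^sup>2 = r\<^sup>2" using assms by (simp add: q_def Y_def)
  have 1: "x - y = X - Y" "x - reflection_point c r y = X - q *\<^sub>R Y"
    by (auto simp: X_def Y_def q_def reflection_point_def)
  have 2: "(norm (X - Y))\<^sup>2 = (norm X)\<^sup>2 + (norm Y)\<^sup>2 - 2 * (X \<bullet> Y)"
    "(norm (X - q *\<^sub>R Y))\<^sup>2 = (norm X)\<^sup>2 + q * (q * (norm Y)\<^sup>2) - 2 * q * (X \<bullet> Y)"
    unfolding power2_norm_eq_inner
    by (simp_all add: inner_diff_left inner_diff_right inner_commute[of Y X] algebra_simps)
  have "(norm Y)\<^sup>2 * (norm (X - q *\<^sub>R Y))\<^sup>2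
      = (norm Y)\<^sup>2 * (norm X)\<^sup>2 + (q * (norm Y)\<^sup>2) * (q * (norm Y)\<^sup>2) - 2 * (q * (norm Y)\<^sup>2) * (X \<bullet> Y)"
    unfolding 2 by (simp add: algebra_simps)
  then show ?thesis
    unfolding 1 X_def[symmetric] Y_def[symmetric] q unfolding 2(1) by (simp add: algebra_simps)
qed

lemma norm_reflection_point:
  assumes "y \<noteq> c"
  shows "norm (reflection_point c r y - c) = r\<^sup>2 / norm (y - c)"
  using assms by (simp add: reflection_point_def power2_eq_square)

lemma disk_kernel_eq_ln:
  assumes "r > 0" "y \<noteq> c" "x \<noteq> reflection_point c r y"
  shows "disk_kernel c r x y =
    1 / (4 * pi) * ln ((norm (y - c))\<^sup>2 / r\<^sup>2) + 1 / (2 * pi) * ln (norm (x - reflection_point c r y))"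
proof -
  let ?p = "reflection_point c r y"
  have "ln ((norm (y - c))\<^sup>2 * (norm (x - ?p))\<^sup>2 / r\<^sup>2) = ln ((norm (y - c))\<^sup>2 / r\<^sup>2 * (norm (x - ?p))\<^sup>2)"
    by (simp add: field_simps)
  also have "\<dots> = ln ((norm (y - c))\<^sup>2 / r\<^sup>2) + ln ((norm (x - ?p))\<^sup>2)"
    using assms by (subst ln_mult) auto
  also have "ln ((norm (x - ?p))\<^sup>2) = 2 * ln (norm (x - ?p))"
    using assms by (subst ln_realpow) auto
  finally show ?thesis
    unfolding disk_kernel_def reflection_point_identity[OF assms(2)] by (simp add: field_simps)
qed

lemma harmonic_at_log:
  fixes x p :: "'a::euclidean_space"
  assumes "DIM('a) = 2" "x \<noteq> p"
  shows "harmonic_at (\<lambda>z. A + B * ln (norm (z - p))) x"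
proof (rule harmonic_at_cong[of "\<lambda>z. A + B / 2 * ln ((norm (z - p))\<^sup>2)" _ "- {p}"])
  show "harmonic_at (\<lambda>z. A + B / 2 * ln ((norm (z - p))\<^sup>2)) x"
    by (intro harmonic_at_add harmonic_at_const harmonic_at_cmult harmonic_at_ln_norm_sq assms)
  fix z assume "z \<in> - {p}"
  then show "A + B * ln (norm (z - p)) = A + B / 2 * ln ((norm (z - p))\<^sup>2)"
    by (subst ln_realpow) auto
qed (use assms in auto)

lemma harmonic_at_disk_kernel:
  fixes x y c :: "'a::euclidean_space"
  assumes "DIM('a) = 2" "r > 0" "y \<noteq> c" "x \<noteq> reflection_point c r y"
  shows "harmonic_at (\<lambda>z. disk_kernel c r z y) x"
  by (rule harmonic_at_cong[OF harmonic_at_log[OF assms(1,4)], of "- {reflection_point c r y}"])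
    (use assms in \<open>auto intro: disk_kernel_eq_ln\<close>)

lemma continuous_on_disk_kernel:
  assumes "r > 0" "y \<noteq> c" "reflection_point c r y \<notin> S"
  shows "continuous_on S (\<lambda>z. disk_kernel c r z y)"
proof -
  let ?p = "reflection_point c r y"
  have "continuous_on S (\<lambda>z. 1 / (4 * pi) * ln ((norm (y - c))\<^sup>2 / r\<^sup>2) + 1 / (2 * pi) * ln (norm (z - ?p)))"
    by (intro continuous_intros) (use assms in auto)
  then show ?thesis
    by (rule continuous_on_eq) (metis assms disk_kernel_eq_ln)
qed

text \<open>For two points on the same side of the circle this is the Green function of the disk or
  of its exterior. As the logarithm of 1 plus a nonnegative quotient it shows its sign and is ready
  for the Harnack estimate.\<close>

lemma disk_kernel_minus_ln:
  assumes "r > 0" "x \<noteq> y" "0 \<le> ((norm (x - c))\<^sup>2 - r\<^sup>2) * ((norm (y - c))\<^sup>2 - r\<^sup>2)"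
  shows "disk_kernel c r x y - 1 / (2 * pi) * ln (norm (x - y)) = 1 / (4 * pi) *
    ln (1 + ((norm (x - c))\<^sup>2 - r\<^sup>2) * ((norm (y - c))\<^sup>2 - r\<^sup>2) / (r\<^sup>2 * (norm (x - y))\<^sup>2))"
proof -
  define P where "P = ((norm (x - c))\<^sup>2 - r\<^sup>2) * ((norm (y - c))\<^sup>2 - r\<^sup>2)"
  define N where "N = (norm (x - y))\<^sup>2"
  have N: "N > 0" using assms by (simp add: N_def)
  have P: "P \<ge> 0" using assms by (simp add: P_def)
  have lnN: "ln N = 2 * ln (norm (x - y))" unfolding N_def using assms by (subst ln_realpow) auto
  have "(r\<^sup>2 * N + P) / r\<^sup>2 = N * (1 + P / (r\<^sup>2 * N))"
    using N assms(1) by (simp add: field_simps)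
  then have "ln ((r\<^sup>2 * N + P) / r\<^sup>2) = ln (N * (1 + P / (r\<^sup>2 * N)))" by simp
  also have "\<dots> = ln N + ln (1 + P / (r\<^sup>2 * N))"
    using N P assms(1) by (intro ln_mult_pos) (auto intro!: add_pos_nonneg)
  finally show ?thesis
    unfolding disk_kernel_def P_def[symmetric] N_def[symmetric] lnN by (simp add: field_simps)
qed

lemma ln_le_disk_kernel:
  assumes "r > 0" "x \<noteq> y" "r \<le> norm (x - c)" "r \<le> norm (y - c)"
  shows "1 / (2 * pi) * ln (norm (x - y)) \<le> disk_kernel c r x y"
proof -
  have P: "0 \<le> ((norm (x - c))\<^sup>2 - r\<^sup>2) * ((norm (y - c))\<^sup>2 - r\<^sup>2)"
    using assms by (intro mult_nonneg_nonneg) (auto intro!: power_mono)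
  have "0 \<le> 1 / (4 * pi) *
    ln (1 + ((norm (x - c))\<^sup>2 - r\<^sup>2) * ((norm (y - c))\<^sup>2 - r\<^sup>2) / (r\<^sup>2 * (norm (x - y))\<^sup>2))"
    using P by (intro mult_nonneg_nonneg ln_ge_zero) auto
  then show ?thesis using disk_kernel_minus_ln[OF assms(1,2) P] by simp
qed

text \<open>With the points on opposite sides the product of the two brackets is nonpositive. The
  argument of the logarithm stays positive, being a multiple of the squared distance from
  \<open>x\<close> to the image pole.\<close>

lemma disk_kernel_le_ln:
  assumes "r > 0" "x \<noteq> y" "y \<noteq> c" "x \<noteq> reflection_point c r y" "r \<le> norm (x - c)" "norm (y - c) \<le> r"
  shows "disk_kernel c r x y \<le> 1 / (2 * pi) * ln (norm (x - y))"
proof -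
  let ?P = "((norm (x - c))\<^sup>2 - r\<^sup>2) * ((norm (y - c))\<^sup>2 - r\<^sup>2)"
  have P: "?P \<le> 0"
    using assms by (intro mult_nonneg_nonpos) (auto intro!: power_mono)
  have "0 < (norm (y - c))\<^sup>2 * (norm (x - reflection_point c r y))\<^sup>2" using assms by simp
  then have Q: "0 < r\<^sup>2 * (norm (x - y))\<^sup>2 + ?P" unfolding reflection_point_identity[OF assms(3)] .
  have "(r\<^sup>2 * (norm (x - y))\<^sup>2 + ?P) / r\<^sup>2 \<le> (norm (x - y))\<^sup>2"
    using P assms(1) by (simp add: field_simps)
  then have "ln ((r\<^sup>2 * (norm (x - y))\<^sup>2 + ?P) / r\<^sup>2) \<le> ln ((norm (x - y))\<^sup>2)"
    using Q assms(1,2) by (subst ln_le_cancel_iff) auto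
  also have "\<dots> = 2 * ln (norm (x - y))" using assms by (subst ln_realpow) auto
  finally have "1 / (4 * pi) * ln ((r\<^sup>2 * (norm (x - y))\<^sup>2 + ?P) / r\<^sup>2) \<le> 1 / (4 * pi) * (2 * ln (norm (x - y)))"
    by (intro mult_left_mono) auto
  then show ?thesis unfolding disk_kernel_def by simp
qed

text \<open>Turns a bound for the quotient of two arguments of the logarithm into a Harnack inequality.\<close>
lemma ln_one_plus_mult_le:
  fixes c t :: real
  assumes "1 \<le> c" "0 \<le> t"
  shows "ln (1 + c * t) \<le> c * ln (1 + t)"
proof -
  \<comment> \<open>\<open>1 + t\<close> is the convex combination of 1 and \<open>1 + c * t\<close>
    in which the latter has weight \<open>1 / c\<close>; concavity gives the claim since
    \<open>ln 1 = 0\<close>.\<close>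
  have "(1 - 1 / c) * ln 1 + 1 / c * ln (1 + c * t) \<le> ln ((1 - 1 / c) *\<^sub>R 1 + (1 / c) *\<^sub>R (1 + c * t))"
    by (rule concave_onD[OF ln_concave]) (use assms in \<open>auto intro!: add_pos_nonneg\<close>)
  also have "(1 - 1 / c) *\<^sub>R 1 + (1 / c) *\<^sub>R (1 + c * t) = 1 + t"
    using assms by (simp add: field_simps)
  finally show ?thesis using assms by (simp add: field_simps)
qed

text \<open>On the diagonal \<open>(norm (x - y))\<^sup>2\<close> is stationary and contributes
  nothing. By \<open>disk_kernel_commute\<close> the same vector is the gradient in the second
  variable, so it counts twice for the diagonal function.\<close>

lemma disk_kernel_has_derivative:
  assumes "r > 0" "r < norm (y - c)"
  shows "((\<lambda>x. disk_kernel c r x y) has_derivative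
    (\<lambda>v. 1 / (2 * pi) * ((y - c) \<bullet> v) / ((norm (y - c))\<^sup>2 - r\<^sup>2))) (at y)"
proof -
  define B where "B = (norm (y - c))\<^sup>2 - r\<^sup>2"
  have B: "B > 0" using assms by (simp add: B_def power_strict_mono)
  define Q where "Q x = (r\<^sup>2 * ((x - y) \<bullet> (x - y)) + ((x - c) \<bullet> (x - c) - r\<^sup>2) * B) / r\<^sup>2" for x
  have Qy: "Q y = B * B / r\<^sup>2" by (simp add: Q_def B_def power2_norm_eq_inner)
  have "(Q has_derivative (\<lambda>v. 2 * ((y - c) \<bullet> v) * B / r\<^sup>2)) (at y)"
    unfolding Q_def
    using assms(1)
    by (auto intro!: derivative_eq_intros simp: inner_commute fun_eq_iff field_simps power2_eq_square)
  then have "((\<lambda>x. 1 / (4 * pi) * ln (Q x)) has_derivative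
      (\<lambda>v. 1 / (4 * pi) * (2 * ((y - c) \<bullet> v) * B / r\<^sup>2 / Q y))) (at y)"
    using B assms(1) by (auto intro!: derivative_eq_intros simp: Qy field_simps)
  moreover have "disk_kernel c r x y = 1 / (4 * pi) * ln (Q x)" for x
    by (simp add: disk_kernel_def Q_def B_def power2_norm_eq_inner)
  moreover have "1 / (4 * pi) * (2 * ((y - c) \<bullet> v) * B / r\<^sup>2 / Q y) =
      1 / (2 * pi) * ((y - c) \<bullet> v) / ((norm (y - c))\<^sup>2 - r\<^sup>2)" for v
    unfolding Qy B_def[symmetric] using B assms(1) by (simp add: field_simps)
  ultimately show ?thesis by simp
qed

text \<open>A Harnack inequality in the pole. Its constant \<open>((d + t) / (d - t))\<^sup>2\<close> does not depend
  on \<open>x\<close>, so the maximum principle transports it from the boundary into the domain.\<close>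
lemma disk_kernel_harnack:
  assumes "r > 0" "d > 0" and y: "norm (y - c) = r + d" and \<tau>: "dist y y' < d" "r \<le> norm (y' - c)"
    and x: "d \<le> norm (x - y)" "r \<le> norm (x - c)"
  shows "disk_kernel c r x y' - 1 / (2 * pi) * ln (norm (x - y')) \<le>
    ((d + dist y y') / (d - dist y y'))\<^sup>2 * (disk_kernel c r x y - 1 / (2 * pi) * ln (norm (x - y)))"
proof -
  define t where "t = dist y y'"
  have t: "0 \<le> t" "t < d" using \<tau> by (auto simp: t_def)
  \<comment> \<open>Moving the pole by \<open>t\<close> enlarges \<open>B\<close> by at most the
    factor ((d + t) / d)^2 and shrinks the squared distance to \<open>x\<close> by no more than ((d
    - t) / d)^2; \<open>C\<close> is the quotient of the two.\<close>
  define C where "C = ((d + t) / (d - t))\<^sup>2"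
  have C: "1 \<le> C" unfolding C_def using t by (intro one_le_power) (simp add: field_simps)
  have neq: "x \<noteq> y" "x \<noteq> y'" using x \<tau> \<open>d > 0\<close> by (auto simp: dist_norm norm_minus_commute)
  define A where "A = (norm (x - c))\<^sup>2 - r\<^sup>2"
  define B where "B z = (norm (z - c))\<^sup>2 - r\<^sup>2" for z
  have A: "A \<ge> 0" using x assms(1) by (simp add: A_def power_mono)
  have B: "B y \<ge> 0" "B y' \<ge> 0" using y \<tau> assms(1,2) by (auto simp: B_def power_mono)
  have By: "B y = d * (2 * r + d)" by (simp add: B_def y power2_eq_square algebra_simps)
  have "norm (y' - c) \<le> r + d + t"
    using norm_triangle_ineq[of "y' - y" "y - c"] y by (simp add: t_def dist_norm norm_minus_commute)
  then have "B y' \<le> (r + d + t)\<^sup>2 - r\<^sup>2" by (simp add: B_def power_mono)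
  also have "\<dots> \<le> ((d + t) / d)\<^sup>2 * B y"
  proof -
    \<comment> \<open>The inner inequality d (2 r + d + t) <= (d + t) (2 r + d) has the difference 2
      r t.\<close>
    have "(d + t) * (d * (2 * r + d + t)) \<le> (d + t) * ((d + t) * (2 * r + d))"
      using t assms(1,2) by (intro mult_left_mono) (auto simp: algebra_simps)
    then have "(d + t) * (2 * r + d + t) \<le> ((d + t) * ((d + t) * (2 * r + d))) / d"
      using \<open>d > 0\<close> by (simp add: pos_le_divide_eq mult.assoc mult.left_commute mult.commute)
    also have "\<dots> = ((d + t) / d)\<^sup>2 * B y"
      unfolding By using \<open>d > 0\<close> by (simp add: power2_eq_square)
    finally show ?thesis by (simp add: power2_eq_square algebra_simps)
  qed
  finally have B': "B y' \<le> ((d + t) / d)\<^sup>2 * B y" .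
  have "norm (x - y) - t \<le> norm (x - y')"
    using norm_triangle_ineq[of "x - y'" "y' - y"] by (simp add: t_def dist_norm norm_minus_commute)
  moreover have "(d - t) / d * norm (x - y) \<le> norm (x - y) - t"
    using mult_left_mono[OF x(1) t(1)] \<open>d > 0\<close> by (simp add: field_simps)
  ultimately have "((d - t) / d * norm (x - y))\<^sup>2 \<le> (norm (x - y'))\<^sup>2"
    using t \<open>d > 0\<close> by (intro power_mono) auto
  then have N': "((d - t) / d)\<^sup>2 * (norm (x - y))\<^sup>2 \<le> (norm (x - y'))\<^sup>2"
    unfolding power_mult_distrib .
  have pos: "0 < ((d - t) / d)\<^sup>2 * (norm (x - y))\<^sup>2" using t \<open>d > 0\<close> neq by simp
  have "B y' / (norm (x - y'))\<^sup>2 \<le> (((d + t) / d)\<^sup>2 * B y) / (((d - t) / d)\<^sup>2 * (norm (x - y))\<^sup>2)"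
    using B' N' B pos by (intro frac_le) auto
  also have "\<dots> = C * (B y / (norm (x - y))\<^sup>2)"
    using t \<open>d > 0\<close> by (simp add: C_def power_divide)
  finally have BN: "B y' / (norm (x - y'))\<^sup>2 \<le> C * (B y / (norm (x - y))\<^sup>2)" .
  define s where "s z = A * B z / (r\<^sup>2 * (norm (x - z))\<^sup>2)" for z
  have s0: "0 \<le> s y" "0 \<le> s y'" using A B by (auto simp: s_def)
  have "s y' = A / r\<^sup>2 * (B y' / (norm (x - y'))\<^sup>2)" by (simp add: s_def)
  also have "\<dots> \<le> A / r\<^sup>2 * (C * (B y / (norm (x - y))\<^sup>2))"
    using BN A by (intro mult_left_mono) auto
  also have "\<dots> = C * s y" by (simp add: s_def)
  finally have "ln (1 + s y') \<le> ln (1 + C * s y)"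
    using s0 by (intro ln_mono) auto
  also have "\<dots> \<le> C * ln (1 + s y)" by (rule ln_one_plus_mult_le[OF C s0(1)])
  finally have "1 / (4 * pi) * ln (1 + s y') \<le> 1 / (4 * pi) * (C * ln (1 + s y))"
    by (intro mult_left_mono) auto
  then show ?thesis
    using disk_kernel_minus_ln[OF assms(1) neq(1), of c] disk_kernel_minus_ln[OF assms(1) neq(2), of c] A B
    by (simp add: s_def A_def B_def C_def t_def mult.left_commute)
qed

text \<open>Both sides agree at \<open>y = x\<close>, so their slopes along a ray can be compared;
  the square of (d + s) / (d - s) has slope 4 / d at s = 0. Testing with \<open>v\<close> and
  \<open>- v\<close> gives the absolute value.\<close>

lemma harnack_imp_gradient_bound:
  fixes f :: "'a::real_normed_vector \<Rightarrow> real"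
  assumes "d > 0" and D: "(f has_derivative D) (at x)"
    and H: "\<And>y. y \<in> ball x d \<Longrightarrow> f y \<le> ((d + dist x y) / (d - dist x y))\<^sup>2 * f x"
  shows "\<bar>D v\<bar> \<le> 4 * f x / d * norm v"
proof -
  have half: "D v \<le> 4 * f x / d * norm v" for v
  proof (rule ccontr)
    assume neg: "\<not> ?thesis"
    define n where "n = norm v"
    have n: "n > 0"
    proof (rule ccontr)
      assume "\<not> n > 0"
      then have "v = 0" by (simp add: n_def)
      then show False using neg linear_0[OF has_derivative_linear[OF D]] by simp
    qed
    define \<phi> where "\<phi> t = ((d + t * n) / (d - t * n))\<^sup>2 * f x - f (x + t *\<^sub>R v)" for t
    have "((\<lambda>t. f (x + t *\<^sub>R v)) has_derivative (\<lambda>t. D (t *\<^sub>R v))) (at 0)"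
      by (rule has_derivative_compose[of "\<lambda>t. x + t *\<^sub>R v" "\<lambda>t. t *\<^sub>R v" 0 UNIV])
        (use D in \<open>auto intro!: derivative_eq_intros\<close>)
    then have 1: "((\<lambda>t. f (x + t *\<^sub>R v)) has_real_derivative D v) (at 0)"
      by (rule has_derivative_imp_has_field_derivative)
        (simp add: linear_cmul[OF has_derivative_linear[OF D]])
    have 2: "((\<lambda>t. ((d + t * n) / (d - t * n))\<^sup>2 * f x) has_real_derivative 4 * n / d * f x) (at 0)"
      using \<open>d > 0\<close> by (auto intro!: derivative_eq_intros simp: field_simps power2_eq_square)
    have "(\<phi> has_real_derivative 4 * n / d * f x - D v) (at 0)"
      unfolding \<phi>_def by (rule DERIV_diff[OF 2 1])
    moreover have "4 * n / d * f x - D v < 0" using neg by (simp add: n_def algebra_simps)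
    ultimately obtain e where e: "e > 0" "\<And>h. 0 < h \<Longrightarrow> h < e \<Longrightarrow> \<phi> h < \<phi> 0"
      using has_real_derivative_neg_dec_right[of \<phi> "4 * n / d * f x - D v" 0 UNIV] by auto
    define h where "h = min e (d / n) / 2"
    have h: "0 < h" "h < e" "h * n < d"
      using e \<open>d > 0\<close> n by (auto simp: h_def min_def field_simps)
    have "\<phi> 0 = 0" using \<open>d > 0\<close> by (simp add: \<phi>_def)
    moreover have "\<phi> h \<ge> 0"
      using H[of "x + h *\<^sub>R v"] h by (simp add: \<phi>_def dist_norm n_def)
    ultimately show False using e(2)[OF h(1,2)] by simp
  qed
  have "D (- v) = - D v" by (rule linear_neg[OF has_derivative_linear[OF D]])
  then show ?thesis using half[of v] half[of "- v"] by simp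
qed

subsection \<open>Families of harmonic functions depending on a parameter\<close>

text \<open>The vector \<open>p\<close> will run over the boundary seen from the pole, so the bound
  must depend on \<open>p\<close> only through the lower bound \<open>d\<close>. With
  \<open>(norm (p - v))\<^sup>2 = (norm p)\<^sup>2 * (1 + s)\<close> and
  \<open>a = norm v / d\<close>, the radius \<open>d / 8\<close> ensures
  \<open>\<bar>s\<bar> \<le> 1 / 2\<close>. Then 2 s^2 <= 18 a^2, the quadratic part of
  \<open>s\<close> adds a^2, and half of 19 is rounded up to 10.\<close>

lemma ln_norm_taylor:
  fixes p v :: "'a::real_inner"
  assumes "d > 0" "d \<le> norm p" "norm v \<le> d / 8"
  shows "\<bar>ln (norm (p - v)) - ln (norm p) + (p \<bullet> v) / (norm p)\<^sup>2\<bar> \<le> 10 / d\<^sup>2 * (norm v)\<^sup>2"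
proof -
  have p: "norm p > 0" using assms by linarith
  define s where "s = ((norm v)\<^sup>2 - 2 * (p \<bullet> v)) / (norm p)\<^sup>2"
  define a where "a = norm v / d"
  have a: "0 \<le> a" "a \<le> 1 / 8" using assms by (auto simp: a_def field_simps)
  have np: "norm v / norm p \<le> a" unfolding a_def using assms p by (intro divide_left_mono) auto
  have v2: "(norm v)\<^sup>2 / (norm p)\<^sup>2 \<le> a\<^sup>2"
    using power_mono[OF np, of 2] by (simp add: power_divide)
  have pv: "\<bar>p \<bullet> v\<bar> / (norm p)\<^sup>2 \<le> a"
  proof -
    have "\<bar>p \<bullet> v\<bar> / (norm p)\<^sup>2 \<le> norm p * norm v / (norm p)\<^sup>2"
      by (intro divide_right_mono Cauchy_Schwarz_ineq2) auto
    also have "\<dots> = norm v / norm p" using p by (simp add: power2_eq_square)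
    finally show ?thesis using np by linarith
  qed
  have "\<bar>s\<bar> \<le> (norm v)\<^sup>2 / (norm p)\<^sup>2 + 2 * (\<bar>p \<bullet> v\<bar> / (norm p)\<^sup>2)"
  proof -
    have "s = (norm v)\<^sup>2 / (norm p)\<^sup>2 - 2 * ((p \<bullet> v) / (norm p)\<^sup>2)"
      by (simp add: s_def diff_divide_distrib)
    moreover have "\<bar>(p \<bullet> v) / (norm p)\<^sup>2\<bar> = \<bar>p \<bullet> v\<bar> / (norm p)\<^sup>2" by simp
    moreover have "0 \<le> (norm v)\<^sup>2 / (norm p)\<^sup>2" by simp
    ultimately show ?thesis by linarith
  qed
  also have "\<dots> \<le> a\<^sup>2 + 2 * a" using v2 pv by simp
  also have "\<dots> \<le> 3 * a"
  proof -
    have "a * a \<le> 1 * a" using a by (intro mult_right_mono) auto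
    then show ?thesis by (simp add: power2_eq_square)
  qed
  finally have s: "\<bar>s\<bar> \<le> 3 * a" .
  have s2: "s\<^sup>2 \<le> 9 * a\<^sup>2"
    using power_mono[OF s, of 2] by (simp add: power_mult_distrib)
  have s12: "\<bar>s\<bar> \<le> 1 / 2" using s a by linarith
  have e: "(norm (p - v))\<^sup>2 = (norm p)\<^sup>2 * (1 + s)"
  proof -
    have "s * (norm p)\<^sup>2 = (norm v)\<^sup>2 - 2 * (p \<bullet> v)" using p by (simp add: s_def)
    moreover have "(norm (p - v))\<^sup>2 = (norm p)\<^sup>2 + ((norm v)\<^sup>2 - 2 * (p \<bullet> v))"
      by (simp add: power2_norm_eq_inner inner_diff_left inner_diff_right inner_commute[of v p])
    ultimately show ?thesis by (simp add: algebra_simps)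
  qed
  have s1: "1 + s > 0" using s12 by linarith
  have "(norm (p - v))\<^sup>2 > 0" unfolding e using p s1 by simp
  then have pv0: "norm (p - v) > 0" by simp
  have "2 * ln (norm (p - v)) = ln ((norm (p - v))\<^sup>2)" using pv0 by (subst ln_realpow) auto
  also have "\<dots> = ln ((norm p)\<^sup>2) + ln (1 + s)" unfolding e using p s1 by (subst ln_mult) auto
  also have "ln ((norm p)\<^sup>2) = 2 * ln (norm p)" using p by (subst ln_realpow) auto
  finally have ln: "2 * ln (norm (p - v)) = 2 * ln (norm p) + ln (1 + s)" .
  have "s = (norm v)\<^sup>2 / (norm p)\<^sup>2 - 2 * ((p \<bullet> v) / (norm p)\<^sup>2)"
    by (simp add: s_def diff_divide_distrib)
  then have eq: "2 * (ln (norm (p - v)) - ln (norm p) + (p \<bullet> v) / (norm p)\<^sup>2)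
      = (ln (1 + s) - s) + (norm v)\<^sup>2 / (norm p)\<^sup>2"
    using ln by simp
  have "\<bar>ln (1 + s) - s\<bar> \<le> 18 * a\<^sup>2"
    using abs_ln_one_plus_x_minus_x_bound[OF s12] s2 by linarith
  then have "\<bar>2 * (ln (norm (p - v)) - ln (norm p) + (p \<bullet> v) / (norm p)\<^sup>2)\<bar>
      \<le> 18 * a\<^sup>2 + (norm v)\<^sup>2 / (norm p)\<^sup>2"
    unfolding eq by (intro order_trans[OF abs_triangle_ineq] add_mono) auto
  then have "2 * \<bar>ln (norm (p - v)) - ln (norm p) + (p \<bullet> v) / (norm p)\<^sup>2\<bar> \<le> 19 * a\<^sup>2"
    using v2 unfolding abs_mult by simp
  then have "\<bar>ln (norm (p - v)) - ln (norm p) + (p \<bullet> v) / (norm p)\<^sup>2\<bar> \<le> 10 * a\<^sup>2"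
    using zero_le_power2[of a] by argo
  then show ?thesis by (simp add: a_def power_divide)
qed

text \<open>Differentiability in the parameter passes from the boundary values to the interior, because
  the maximum principle makes the difference quotients uniformly Cauchy. In particular neither the
  symmetry nor the joint smoothness of the Green function has to be known.\<close>
lemma harmonic_family_differentiable:
  fixes k :: "'a::euclidean_space \<Rightarrow> 'b::euclidean_space \<Rightarrow> real"
  assumes V: "open V" "bounded V" and "r > 0" and "C \<ge> 0"
    and cont: "\<And>v. norm v < r \<Longrightarrow> continuous_on (closure V) (\<lambda>x. k x (y + v))"
    and harm: "\<And>v x. norm v < r \<Longrightarrow> x \<in> V \<Longrightarrow> harmonic_at (\<lambda>x. k x (y + v)) x"
    and l: "\<And>x. x \<in> frontier V \<Longrightarrow> linear (l x)"
    and bd: "\<And>x v. x \<in> frontier V \<Longrightarrow> norm v < r \<Longrightarrow>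
        \<bar>k x (y + v) - k x y - l x v\<bar> \<le> C * (norm v)\<^sup>2"
  obtains w where "continuous_on (closure V) w"
    and "\<And>x v. x \<in> closure V \<Longrightarrow> norm v < r \<Longrightarrow>
        \<bar>k x (y + v) - k x y - w x \<bullet> v\<bar> \<le> C * (norm v)\<^sup>2"
proof -
  \<comment> \<open>The offset 2 keeps every step strictly below \<open>r\<close>, already for
    \<open>n = 0\<close>.\<close>
  define s where "s n = r / real (n + 2)" for n
  have s: "0 < s n" "s n < r" for n
    using \<open>r > 0\<close> by (auto simp: s_def field_simps intro!: add_pos_nonneg)
  have s_lim: "s \<longlonglongrightarrow> 0"
    unfolding s_def by (rule LIMSEQ_ignore_initial_segment[OF lim_const_over_n])
  define q where "q b n x = (k x (y + s n *\<^sub>R b) - k x y) / s n" for b :: 'b and n x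
  have sb: "norm (s n *\<^sub>R b) < r" if "b \<in> Basis" for b :: 'b and n using s[of n] that by simp
  have cont0: "continuous_on (closure V) (\<lambda>x. k x y)" using cont[of 0] \<open>r > 0\<close> by simp
  have harm0: "harmonic_at (\<lambda>x. k x y) x" if "x \<in> V" for x using harm[of 0 x] \<open>r > 0\<close> that by simp
  have contq: "continuous_on (closure V) (q b n)" if "b \<in> Basis" for b n
    unfolding q_def using s[of n] by (intro continuous_intros cont0 cont sb that) auto
  have harmq: "harmonic_at (q b n) x" if "b \<in> Basis" "x \<in> V" for b n x
  proof -
    have "harmonic_at (\<lambda>x. 1 / s n * (k x (y + s n *\<^sub>R b) - k x y)) x"
      by (intro harmonic_at_cmult harmonic_at_diff harm0 harm sb that)
    then show ?thesis by (simp add: q_def[abs_def])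
  qed
  have ql: "\<bar>q b n x - l x b\<bar> \<le> C * s n" if "b \<in> Basis" "x \<in> frontier V" for b n x
  proof -
    have "\<bar>k x (y + s n *\<^sub>R b) - k x y - l x (s n *\<^sub>R b)\<bar> \<le> C * (norm (s n *\<^sub>R b))\<^sup>2"
      by (rule bd) (use that sb in auto)
    also have "l x (s n *\<^sub>R b) = s n * l x b" using linear_cmul[OF l[OF that(2)]] by simp
    also have "C * (norm (s n *\<^sub>R b))\<^sup>2 = C * s n * s n" using that by (simp add: power2_eq_square)
    also have "k x (y + s n *\<^sub>R b) - k x y - s n * l x b = (q b n x - l x b) * s n"
      using s(1)[of n] by (simp add: q_def field_simps)
    finally have "\<bar>q b n x - l x b\<bar> * s n \<le> C * s n * s n"
      using s(1)[of n] by (simp add: abs_mult)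
    then show ?thesis using s(1)[of n] by simp
  qed
  have qq: "\<bar>q b n x - q b m x\<bar> \<le> C * s n + C * s m" if b: "b \<in> Basis" and x: "x \<in> closure V" for b n m x
  proof (rule maximum_principle_abs[OF V _ _ _ x, of "\<lambda>x. q b n x - q b m x"])
    show "continuous_on (closure V) (\<lambda>x. q b n x - q b m x)" by (intro continuous_intros contq b)
    show "harmonic_at (\<lambda>x. q b n x - q b m x) x" if "x \<in> V" for x
      by (intro harmonic_at_diff harmq b that)
    show "\<bar>q b n x - q b m x\<bar> \<le> C * s n + C * s m" if "x \<in> frontier V" for x
      using ql[OF b that, of n] ql[OF b that, of m] by linarith
  qed
  have "\<exists>f. uniform_limit (closure V) (q b) f sequentially" if b: "b \<in> Basis" for b
  proof -
    have "uniformly_Cauchy_on (closure V) (q b)"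
      unfolding uniformly_Cauchy_on_def
    proof (intro allI impI)
      fix e :: real assume "e > 0"
      have "(\<lambda>n. C * s n) \<longlonglongrightarrow> C * 0" by (intro tendsto_intros s_lim)
      then have "\<forall>\<^sub>F n in sequentially. C * s n < e / 2"
        using \<open>e > 0\<close> by (intro order_tendstoD) auto
      then obtain M where M: "\<And>n. n \<ge> M \<Longrightarrow> C * s n < e / 2"
        by (auto simp: eventually_sequentially)
      have "dist (q b m x) (q b n x) < e" if "x \<in> closure V" "m \<ge> M" "n \<ge> M" for x m n
        using qq[OF b that(1), of m n] M[OF that(2)] M[OF that(3)] by (simp add: dist_real_def)
      then show "\<exists>M. \<forall>x\<in>closure V. \<forall>m\<ge>M. \<forall>n\<ge>M. dist (q b m x) (q b n x) < e" by blast
    qed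
    then show ?thesis
      using Cauchy_uniformly_convergent uniformly_convergent_on_def by blast
  qed
  then obtain f where f: "\<And>b. b \<in> Basis \<Longrightarrow> uniform_limit (closure V) (q b) (f b) sequentially"
    by metis
  have contf: "continuous_on (closure V) (f b)" if "b \<in> Basis" for b
    by (rule uniform_limit_theorem[OF _ f[OF that]]) (use contq that in auto)
  define w where "w x = (\<Sum>b\<in>Basis. f b x *\<^sub>R b)" for x
  have w: "w x \<bullet> v = (\<Sum>b\<in>Basis. (v \<bullet> b) * f b x)" for x v
    unfolding w_def inner_sum_left by (simp add: inner_commute mult.commute)
  show ?thesis
  proof (rule that[of w])
    show "continuous_on (closure V) w"
      unfolding w_def by (intro continuous_intros contf)
    fix x v assume x: "x \<in> closure V" and v: "norm (v::'b) < r"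
    define M where "M = (\<Sum>b\<in>Basis. \<bar>v \<bullet> b\<bar>)"
    \<comment> \<open>The limits \<open>f b\<close> have not been shown to be harmonic, so the
      maximum principle is applied with the quotients \<open>q b n\<close>; the extra term
      \<open>M * (C * s n)\<close> disappears in the limit.\<close>
    have "\<bar>k x (y + v) - k x y - (\<Sum>b\<in>Basis. (v \<bullet> b) * q b n x)\<bar> \<le> C * (norm v)\<^sup>2 + M * (C * s n)" for n
    proof (rule maximum_principle_abs[OF V _ _ _ x,
          of "\<lambda>x. k x (y + v) - k x y - (\<Sum>b\<in>Basis. (v \<bullet> b) * q b n x)"])
      show "continuous_on (closure V) (\<lambda>x. k x (y + v) - k x y - (\<Sum>b\<in>Basis. (v \<bullet> b) * q b n x))"
        by (intro continuous_intros cont0 cont v contq)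
      show "harmonic_at (\<lambda>x. k x (y + v) - k x y - (\<Sum>b\<in>Basis. (v \<bullet> b) * q b n x)) x"
        if "x \<in> V" for x
        by (intro harmonic_at_intros harm0 harm harmq that v)
      fix x assume x: "x \<in> frontier V"
      have "l x v = l x (\<Sum>b\<in>Basis. (v \<bullet> b) *\<^sub>R b)" by (simp add: euclidean_representation)
      also have "\<dots> = (\<Sum>b\<in>Basis. (v \<bullet> b) * l x b)"
        using l[OF x] by (simp add: linear_sum linear_cmul)
      finally have "\<bar>(\<Sum>b\<in>Basis. (v \<bullet> b) * q b n x) - l x v\<bar> = \<bar>\<Sum>b\<in>Basis. (v \<bullet> b) * (q b n x - l x b)\<bar>"
        by (simp add: right_diff_distrib sum_subtractf)
      also have "\<dots> \<le> (\<Sum>b\<in>Basis. \<bar>v \<bullet> b\<bar> * (C * s n))"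
        using ql[OF _ x] by (intro order_trans[OF sum_abs] sum_mono) (simp add: abs_mult mult_left_mono)
      also have "\<dots> = M * (C * s n)" by (simp add: M_def sum_distrib_right)
      finally show "\<bar>k x (y + v) - k x y - (\<Sum>b\<in>Basis. (v \<bullet> b) * q b n x)\<bar> \<le> C * (norm v)\<^sup>2 + M * (C * s n)"
        using bd[OF x v] by linarith
    qed
    moreover have "(\<lambda>n. \<bar>k x (y + v) - k x y - (\<Sum>b\<in>Basis. (v \<bullet> b) * q b n x)\<bar>)
        \<longlonglongrightarrow> \<bar>k x (y + v) - k x y - (\<Sum>b\<in>Basis. (v \<bullet> b) * f b x)\<bar>"
      by (intro tendsto_intros tendsto_uniform_limitI[OF f x])
    moreover have "(\<lambda>n. C * (norm v)\<^sup>2 + M * (C * s n)) \<longlonglongrightarrow> C * (norm v)\<^sup>2 + M * (C * 0)"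
      by (intro tendsto_intros s_lim)
    ultimately have "\<bar>k x (y + v) - k x y - (\<Sum>b\<in>Basis. (v \<bullet> b) * f b x)\<bar> \<le> C * (norm v)\<^sup>2 + M * (C * 0)"
      by (intro LIMSEQ_le) auto
    then show "\<bar>k x (y + v) - k x y - w x \<bullet> v\<bar> \<le> C * (norm v)\<^sup>2" by (simp add: w)
  qed
qed

section \<open>Derivatives along the diagonal\<close>

lemma has_derivative_zeroI:
  fixes f :: "'a::{real_normed_vector,perfect_space} \<Rightarrow> 'b::real_normed_vector"
  assumes "\<forall>\<^sub>F z in at a. norm (f z) \<le> e z * norm (z - a)" "(e \<longlongrightarrow> 0) (at a)" "f a = 0"
  shows "(f has_derivative (\<lambda>_. 0)) (at a)"
  unfolding has_derivative_def
proof (intro conjI bounded_linear_zero)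
  show "((\<lambda>y. ((f y - f (Lim (at a) (\<lambda>x. x))) - 0) /\<^sub>R norm (y - Lim (at a) (\<lambda>x. x))) \<longlongrightarrow> 0) (at a)"
  proof (rule Lim_null_comparison[OF _ assms(2)])
    have ne: "\<forall>\<^sub>F z in at a. z \<noteq> a" by (simp add: eventually_at_filter)
    have lim: "Lim (at a) (\<lambda>x. x) = a" by (rule tendsto_Lim) auto
    show "\<forall>\<^sub>F y in at a. norm (((f y - f (Lim (at a) (\<lambda>x. x))) - 0) /\<^sub>R norm (y - Lim (at a) (\<lambda>x. x))) \<le> e y"
      using assms(1) ne unfolding lim by eventually_elim (simp add: assms(3) field_simps)
  qed
qed

text \<open>\<open>k z z - k z a\<close> is expanded in the second argument with a remainder uniform
  in the first; continuity of \<open>w\<close> at \<open>a\<close> allows \<open>w a\<close> in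
  place of \<open>w z\<close>, and \<open>D\<close> accounts for the change of
  \<open>k z a\<close>.\<close>

lemma diagonal_has_derivative:
  fixes k :: "'a::euclidean_space \<Rightarrow> 'a \<Rightarrow> real"
  assumes V: "open V" "a \<in> V" and "r > 0"
    and w: "continuous_on V w"
    and bd: "\<And>x v. x \<in> V \<Longrightarrow> norm v < r \<Longrightarrow> \<bar>k x (a + v) - k x a - w x \<bullet> v\<bar> \<le> C * (norm v)\<^sup>2"
    and D: "((\<lambda>x. k x a) has_derivative D) (at a)"
  shows "((\<lambda>z. k z z) has_derivative (\<lambda>v. D v + w a \<bullet> v)) (at a)"
    and "((\<lambda>z. k a z) has_derivative (\<lambda>v. w a \<bullet> v)) (at a)"
proof -
  have nearV: "\<forall>\<^sub>F z in at a. z \<in> V" using V by (simp add: eventually_at_in_open')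
  have nearr: "\<forall>\<^sub>F z in at a. norm (z - a) < r"
    using eventually_at_ball[OF \<open>r > 0\<close>, of a UNIV] by eventually_elim (simp add: dist_norm norm_minus_commute)
  have wa: "(w \<longlongrightarrow> w a) (at a)"
    using w V by (simp add: continuous_on_eq_continuous_at isCont_def)
  have "((\<lambda>z. k z z - k z a - w a \<bullet> (z - a)) has_derivative (\<lambda>_. 0)) (at a)"
  proof (rule has_derivative_zeroI)
    show "\<forall>\<^sub>F z in at a. norm (k z z - k z a - w a \<bullet> (z - a)) \<le> (C * norm (z - a) + norm (w z - w a)) * norm (z - a)"
      using nearV nearr
    proof eventually_elim
      case (elim z)
      have "\<bar>k z z - k z a - w z \<bullet> (z - a)\<bar> \<le> C * (norm (z - a))\<^sup>2"
        using bd[OF elim] by simp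
      moreover have "\<bar>(w z - w a) \<bullet> (z - a)\<bar> \<le> norm (w z - w a) * norm (z - a)"
        by (rule Cauchy_Schwarz_ineq2)
      ultimately show ?case by (simp add: inner_diff_left power2_eq_square algebra_simps)
    qed
    have "((\<lambda>z. C * norm (z - a) + norm (w z - w a)) \<longlongrightarrow> C * norm (a - a) + norm (w a - w a)) (at a)"
      by (intro tendsto_intros wa)
    then show "((\<lambda>z. C * norm (z - a) + norm (w z - w a)) \<longlongrightarrow> 0) (at a)" by simp
  qed simp
  moreover have "((\<lambda>z. w a \<bullet> (z - a)) has_derivative (\<lambda>v. w a \<bullet> v)) (at a)"
    by (auto intro!: derivative_eq_intros)
  ultimately have "((\<lambda>z. k z z - k z a - w a \<bullet> (z - a) + k z a + w a \<bullet> (z - a)) has_derivative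
      (\<lambda>v. 0 + D v + w a \<bullet> v)) (at a)"
    by (intro has_derivative_add D)
  then show "((\<lambda>z. k z z) has_derivative (\<lambda>v. D v + w a \<bullet> v)) (at a)" by simp
  have "((\<lambda>z. k a z - k a a - w a \<bullet> (z - a)) has_derivative (\<lambda>_. 0)) (at a)"
  proof (rule has_derivative_zeroI)
    show "\<forall>\<^sub>F z in at a. norm (k a z - k a a - w a \<bullet> (z - a)) \<le> (C * norm (z - a)) * norm (z - a)"
      using nearr
    proof eventually_elim
      case (elim z)
      show ?case using bd[OF V(2) elim] by (simp add: power2_eq_square mult.assoc)
    qed
    have "((\<lambda>z. C * norm (z - a)) \<longlongrightarrow> C * norm (a - a)) (at a)" by (intro tendsto_intros)
    then show "((\<lambda>z. C * norm (z - a)) \<longlongrightarrow> 0) (at a)" by simp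
  qed simp
  moreover have "((\<lambda>z. k a a + w a \<bullet> (z - a)) has_derivative (\<lambda>v. w a \<bullet> v)) (at a)"
    by (auto intro!: derivative_eq_intros)
  ultimately have "((\<lambda>z. k a z - k a a - w a \<bullet> (z - a) + (k a a + w a \<bullet> (z - a))) has_derivative
      (\<lambda>v. 0 + w a \<bullet> v)) (at a)"
    by (rule has_derivative_add)
  then show "((\<lambda>z. k a z) has_derivative (\<lambda>v. w a \<bullet> v)) (at a)" by simp
qed

subsection \<open>Disks tangent to the boundary\<close>

text \<open>A nonzero remainder would be orthogonal to \<open>e1\<close> and \<open>e2\<close>,
  giving three independent vectors in dimension 2.\<close>

lemma orthonormal_pair_expansion:
  fixes e1 e2 z :: "'a::euclidean_space"
  assumes "DIM('a) = 2" "norm e1 = 1" "norm e2 = 1" "e1 \<bullet> e2 = 0"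
  shows "z = (z \<bullet> e1) *\<^sub>R e1 + (z \<bullet> e2) *\<^sub>R e2"
proof (rule ccontr)
  define u where "u = z - ((z \<bullet> e1) *\<^sub>R e1 + (z \<bullet> e2) *\<^sub>R e2)"
  assume "\<not> ?thesis"
  then have u: "u \<noteq> 0" by (simp add: u_def)
  have e: "e1 \<bullet> e1 = 1" "e2 \<bullet> e2 = 1" "e2 \<bullet> e1 = 0"
    using assms by (auto simp: norm_eq_1 inner_commute)
  have o: "u \<bullet> e1 = 0" "u \<bullet> e2 = 0"
    by (auto simp: u_def inner_diff_left inner_add_left e assms(4))
  have nz: "e1 \<noteq> 0" "e2 \<noteq> 0" using assms by auto
  have neq: "e1 \<noteq> e2" "u \<noteq> e1" "u \<noteq> e2" using e assms(4) o u by auto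
  have "pairwise orthogonal {u, e1, e2}"
    using o e assms(4) by (auto simp: pairwise_def orthogonal_def inner_commute)
  then have "independent {u, e1, e2}"
    by (rule pairwise_orthogonal_independent) (use u nz in auto)
  then have "card {u, e1, e2} \<le> DIM('a)" using independent_bound by blast
  then show False using neq assms(1) by simp
qed

text \<open>The normal of any chart turns out to point from the centre of an inner touching disk to
  \<open>s\<close>. The graph avoids the disk, so the squared distance to \<open>c\<close> along it
  is minimal at \<open>s\<close>, and \<open>c - s\<close> is orthogonal to the tangent; the segment
  from \<open>s\<close> to \<open>c\<close> runs inside the domain, which fixes the sign.\<close>

lemma interior_disk_center:
  fixes \<Omega> :: "(real^2) set"
  assumes "open \<Omega>" "s \<in> frontier \<Omega>" and chart: "C2_graph_chart \<Omega> s \<rho> e1 e2 g"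
    and n: "n = (1 / sqrt (1 + (deriv g (s \<bullet> e1))\<^sup>2)) *\<^sub>R (deriv g (s \<bullet> e1) *\<^sub>R e1 - e2)"
    and ball: "ball c r \<subseteq> \<Omega>" and r: "r > 0" "dist c s = r"
  shows "s = c + r *\<^sub>R n"
proof -
  have \<rho>: "\<rho> > 0" and e: "norm e1 = 1" "norm e2 = 1" "e1 \<bullet> e2 = 0" and "C2_on g UNIV"
    and \<Omega>: "\<Omega> \<inter> ball s \<rho> = {z \<in> ball s \<rho>. g (z \<bullet> e1) < z \<bullet> e2}"
    using chart unfolding C2_graph_chart_def by auto
  have ee: "e1 \<bullet> e1 = 1" "e2 \<bullet> e2 = 1" "e2 \<bullet> e1 = 0"
    using e by (auto simp: norm_eq_1 inner_commute)
  have \<Omega>': "z \<in> \<Omega> \<longleftrightarrow> g (z \<bullet> e1) < z \<bullet> e2" if "z \<in> ball s \<rho>" for z using \<Omega> that by blast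
  have gdiff: "(g has_real_derivative deriv g t) (at t)" for t
  proof -
    obtain f' :: "real \<Rightarrow> real \<Rightarrow>\<^sub>L real" where "(g has_derivative blinfun_apply (f' t)) (at t)"
      using \<open>C2_on g UNIV\<close> unfolding C2_on_def by blast
    then have "g differentiable (at t)" by (rule differentiableI)
    then show ?thesis using DERIV_deriv_iff_real_differentiable by blast
  qed
  define a where "a = s \<bullet> e1"
  define g' where "g' = deriv g a"
  have ga: "(g has_real_derivative g') (at a)" unfolding g'_def by (rule gdiff)
  define p where "p = c - s"
  define p1 p2 where "p1 = p \<bullet> e1" and "p2 = p \<bullet> e2"
  have np: "norm p = r" using r by (simp add: p_def dist_norm)
  have s\<Omega>: "s \<notin> \<Omega>" using assms(1,2) by (simp add: frontier_def interior_open)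
  then have ge: "s \<bullet> e2 \<le> g a" using \<Omega>'[of s] \<rho> by (simp add: a_def)
  \<comment> \<open>Negative when \<open>s + t *\<^sub>R p\<close> lies above the graph, as it does
    for small \<open>t > 0\<close> because this point is in the disk; \<open>t < \<rho> / r\<close>
    keeps it within the chart.\<close>
  define \<psi> where "\<psi> t = g (a + t * p1) - s \<bullet> e2 - t * p2" for t
  have \<psi>neg: "\<psi> t < 0" if t: "0 < t" "t < 1" "t < \<rho> / r" for t
  proof -
    have "dist c (s + t *\<^sub>R p) = norm ((1 - t) *\<^sub>R p)" by (simp add: dist_norm p_def algebra_simps)
    also have "\<dots> < r" using t np r by simp
    finally have "s + t *\<^sub>R p \<in> \<Omega>" using ball by auto
    moreover have "s + t *\<^sub>R p \<in> ball s \<rho>"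
      using t r np by (simp add: dist_norm pos_less_divide_eq)
    ultimately have "g ((s + t *\<^sub>R p) \<bullet> e1) < (s + t *\<^sub>R p) \<bullet> e2" using \<Omega>' by blast
    then show ?thesis by (simp add: \<psi>_def a_def p1_def p2_def inner_add_left)
  qed
  have \<psi>d: "(\<psi> has_real_derivative g' * p1 - p2) (at 0)"
  proof -
    have "((\<lambda>t. g (a + t * p1)) has_real_derivative g' * p1) (at 0)"
      by (rule DERIV_chain2[of g]) (use ga in \<open>auto intro!: derivative_eq_intros\<close>)
    then show ?thesis unfolding \<psi>_def by (auto intro!: derivative_eq_intros)
  qed
  define h0 where "h0 = min 1 (\<rho> / r)"
  have h0: "h0 > 0" using \<rho> r by (simp add: h0_def)
  \<comment> \<open>A chart describes \<open>\<Omega>\<close> and not its frontier: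
    \<open>s \<notin> \<Omega>\<close> puts \<open>s\<close> on or below the graph, and the limit
    along the segment puts it on or above.\<close>
  have "\<psi> 0 \<le> 0"
  proof (rule tendsto_upperbound)
    show "(\<psi> \<longlongrightarrow> \<psi> 0) (at_right 0)"
      using DERIV_isCont[OF \<psi>d] by (simp add: isCont_def filterlim_at_split)
    show "\<forall>\<^sub>F t in at_right 0. \<psi> t \<le> 0"
      using eventually_at_right_real[OF h0] by eventually_elim (use \<psi>neg in \<open>auto simp: h0_def less_imp_le\<close>)
  qed simp
  with ge have gs: "g a = s \<bullet> e2" by (simp add: \<psi>_def)
  then have \<psi>0: "\<psi> 0 = 0" by (simp add: \<psi>_def)
  have side: "g' * p1 - p2 \<le> 0"
  proof (rule ccontr)
    assume "\<not> ?thesis"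
    then obtain d where d: "d > 0" "\<And>h. 0 < h \<Longrightarrow> h < d \<Longrightarrow> \<psi> 0 < \<psi> h"
      using has_real_derivative_pos_inc_right[of \<psi> "g' * p1 - p2" 0 UNIV] \<psi>d by auto
    define h where "h = min d h0 / 2"
    have "0 < h" "h < d" "h < h0" using d h0 by (auto simp: h_def)
    then show False using d(2)[of h] \<psi>neg[of h] \<psi>0 by (simp add: h0_def)
  qed
  define \<gamma> where "\<gamma> t = s + t *\<^sub>R e1 + (g (a + t) - g a) *\<^sub>R e2" for t
  define \<eta> where "\<eta> t = r\<^sup>2 + t\<^sup>2 + (g (a + t) - g a)\<^sup>2 - 2 * t * p1 - 2 * (g (a + t) - g a) * p2" for t
  have gt: "((\<lambda>t. g (a + t)) has_real_derivative g') (at 0)"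
    using ga DERIV_shift[of g g' 0 a] by (simp add: add.commute)
  have \<eta>: "\<eta> t = (norm (\<gamma> t - c))\<^sup>2" for t
  proof -
    have "\<gamma> t - c = t *\<^sub>R e1 + (g (a + t) - g a) *\<^sub>R e2 - p" by (simp add: \<gamma>_def p_def)
    moreover have "p \<bullet> p = r\<^sup>2" using np by (simp add: power2_norm_eq_inner[symmetric])
    moreover have "p \<bullet> e1 = p1" "p \<bullet> e2 = p2" "e1 \<bullet> p = p1" "e2 \<bullet> p = p2"
      by (simp_all add: p1_def p2_def inner_commute)
    ultimately show ?thesis
      by (simp add: \<eta>_def power2_norm_eq_inner inner_add_left inner_add_right inner_diff_left
          inner_diff_right ee e(3)) (simp add: power2_eq_square algebra_simps)
  qed
  have \<eta>d: "(\<eta> has_real_derivative - 2 * p1 - 2 * g' * p2) (at 0)"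
    unfolding \<eta>_def by (auto intro!: derivative_eq_intros gt)
  have "(\<gamma> \<longlongrightarrow> \<gamma> 0) (nhds 0)"
  proof -
    have "isCont (\<lambda>t. g (a + t)) 0" using gt by (rule DERIV_isCont)
    then have "isCont \<gamma> 0" unfolding \<gamma>_def by (intro continuous_intros)
    then show ?thesis by (simp add: isCont_def tendsto_at_iff_tendsto_nhds)
  qed
  then have "\<forall>\<^sub>F t in nhds 0. \<gamma> t \<in> ball s \<rho>"
    by (rule topological_tendstoD) (use \<rho> in \<open>auto simp: \<gamma>_def\<close>)
  then obtain d where d: "d > 0" "\<And>t. \<bar>t\<bar> < d \<Longrightarrow> \<gamma> t \<in> ball s \<rho>"
    by (auto simp: eventually_nhds_metric dist_real_def)
  have \<eta>min: "\<eta> 0 \<le> \<eta> t" if "\<bar>t\<bar> < d" for t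
  proof -
    have "\<gamma> t \<bullet> e1 = a + t" "\<gamma> t \<bullet> e2 = g (a + t)"
      by (auto simp: \<gamma>_def inner_add_left ee e(3) a_def gs[unfolded a_def])
    then have "\<gamma> t \<notin> \<Omega>" using \<Omega>'[OF d(2)[OF that]] by simp
    then have "\<gamma> t \<notin> ball c r" using ball by blast
    then have "r \<le> norm (\<gamma> t - c)" by (simp add: dist_norm norm_minus_commute)
    then have "r\<^sup>2 \<le> (norm (\<gamma> t - c))\<^sup>2" using r by (intro power_mono) auto
    then show ?thesis unfolding \<eta>[symmetric] by (simp add: \<eta>_def)
  qed
  have "- 2 * p1 - 2 * g' * p2 = 0"
    by (rule DERIV_local_min[OF \<eta>d d(1)]) (simp add: \<eta>min)
  then have p1: "p1 = - g' * p2" by simp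
  have q: "1 + g'\<^sup>2 > 0" by (simp add: add_pos_nonneg)
  have "(1 + g'\<^sup>2) * p2 \<ge> 0" using side p1 by (simp add: power2_eq_square algebra_simps)
  then have p2: "p2 \<ge> 0" using q by (simp add: zero_le_mult_iff)
  have pe: "p = p1 *\<^sub>R e1 + p2 *\<^sub>R e2"
    unfolding p1_def p2_def by (rule orthonormal_pair_expansion) (use e in auto)
  have "r\<^sup>2 = p \<bullet> p" using np by (simp add: power2_norm_eq_inner[symmetric])
  also have "\<dots> = p1\<^sup>2 + p2\<^sup>2"
    unfolding pe by (simp add: inner_add_left inner_add_right ee e(3) power2_eq_square)
  also have "\<dots> = (1 + g'\<^sup>2) * p2\<^sup>2" by (simp add: p1 power_mult_distrib algebra_simps)
  finally have "sqrt (r\<^sup>2) = sqrt ((1 + g'\<^sup>2) * p2\<^sup>2)" by simp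
  then have rr: "r = sqrt (1 + g'\<^sup>2) * p2" using r p2 by (simp add: real_sqrt_mult)
  have "r *\<^sub>R n = p2 *\<^sub>R (g' *\<^sub>R e1 - e2)"
    using q by (simp add: n rr g'_def a_def)
  also have "\<dots> = - p" by (simp add: pe p1 algebra_simps)
  finally show ?thesis by (simp add: p_def)
qed

lemma norm_outward_unit_normal:
  assumes "outward_unit_normal \<Omega> s \<nu>"
  shows "norm \<nu> = 1"
proof -
  obtain r e1 e2 g where c: "C2_graph_chart \<Omega> s r e1 e2 g"
    and \<nu>: "\<nu> = (1 / sqrt (1 + (deriv g (s \<bullet> e1))\<^sup>2)) *\<^sub>R (deriv g (s \<bullet> e1) *\<^sub>R e1 - e2)"
    using assms unfolding outward_unit_normal_def by blast
  define g' where "g' = deriv g (s \<bullet> e1)"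
  have ee: "e1 \<bullet> e1 = 1" "e2 \<bullet> e2 = 1" "e2 \<bullet> e1 = 0" "e1 \<bullet> e2 = 0"
    using c by (auto simp: C2_graph_chart_def norm_eq_1 inner_commute)
  have "norm (g' *\<^sub>R e1 - e2) = sqrt (1 + g'\<^sup>2)"
    by (simp add: norm_eq_sqrt_inner inner_diff_left inner_diff_right ee power2_eq_square)
  moreover have "1 + g'\<^sup>2 > 0" by (simp add: add_pos_nonneg)
  ultimately show ?thesis by (simp add: \<nu> g'_def)
qed

lemma outward_unit_normal_interior_disk:
  assumes "open \<Omega>" "outward_unit_normal \<Omega> s \<nu>" "ball c r \<subseteq> \<Omega>" "r > 0" "dist c s = r"
  shows "s = c + r *\<^sub>R \<nu>"
proof -
  obtain \<rho> e1 e2 g where "s \<in> frontier \<Omega>" "C2_graph_chart \<Omega> s \<rho> e1 e2 g"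
    "\<nu> = (1 / sqrt (1 + (deriv g (s \<bullet> e1))\<^sup>2)) *\<^sub>R (deriv g (s \<bullet> e1) *\<^sub>R e1 - e2)"
    using assms(2) unfolding outward_unit_normal_def by blast
  then show ?thesis using assms(1,3-5) by (intro interior_disk_center)
qed

text \<open>Disjointness keeps the centres at least \<open>2 * r\<close> apart, since otherwise
  their midpoint is in both disks. This is the equality case of the triangle inequality through
  \<open>s\<close>, settled by the parallelogram law.\<close>

lemma opposite_tangent_disks:
  fixes a b s :: "'a::real_inner"
  assumes "ball a r \<inter> ball b r = {}" "r > 0" "dist a s = r" "dist b s = r"
  shows "b - s = s - a"
proof -
  have "dist a b \<ge> 2 * r"
  proof (rule ccontr)
    assume "\<not> ?thesis"
    then have "dist a (midpoint a b) < r" "dist b (midpoint a b) < r"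
      by (auto simp: dist_midpoint)
    then show False using assms(1) by auto
  qed
  then have "(2 * r)\<^sup>2 \<le> (norm (a - b))\<^sup>2"
    using assms(2) by (intro power_mono) (auto simp: dist_norm)
  also have "a - b = (a - s) - (b - s)" by simp
  finally have "4 * r\<^sup>2 \<le> (norm ((a - s) - (b - s)))\<^sup>2" by (simp add: power_mult_distrib)
  moreover have "(norm ((a - s) + (b - s)))\<^sup>2 + (norm ((a - s) - (b - s)))\<^sup>2
      = 2 * (norm (a - s))\<^sup>2 + 2 * (norm (b - s))\<^sup>2"
    by (simp add: power2_norm_eq_inner inner_add_left inner_add_right inner_diff_left inner_diff_right)
  ultimately have "(norm ((a - s) + (b - s)))\<^sup>2 \<le> 0"
    using assms(3,4) by (simp only: dist_norm)
  then have "(a - s) + (b - s) = 0" by (simp only: power2_less_eq_zero_iff norm_eq_zero)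
  then show ?thesis by (simp add: algebra_simps)
qed

text \<open>A connected set that meets \<open>S\<close> and misses its frontier cannot leave
  \<open>S\<close>. At distance 0 the ball is empty.\<close>

lemma ball_infdist_frontier_subset:
  fixes x :: "'a::real_normed_vector"
  assumes "x \<in> S" "frontier S \<noteq> {}"
  shows "ball x (infdist x (frontier S)) \<subseteq> S"
proof (cases "infdist x (frontier S) > 0")
  case True
  have "ball x (infdist x (frontier S)) \<inter> frontier S = {}"
    using infdist_le[of _ "frontier S" x] by fastforce
  then show ?thesis
    using connected_Int_frontier[OF connected_ball, of x "infdist x (frontier S)" S] assms(1) True
      centre_in_ball[of x "infdist x (frontier S)"] by blast
next
  case False
  then have "infdist x (frontier S) = 0" using infdist_nonneg[of x "frontier S"] by linarith
  then show ?thesis by simp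
qed

text \<open>The pole \<open>p\<close> may lie in \<open>\<Omega>\<close>, where the logarithm tends to minus infinity: a small disk
  about \<open>p\<close> is removed.\<close>
lemma log_comparison:
  fixes f :: "'a::euclidean_space \<Rightarrow> real"
  assumes dim: "DIM('a) = 2" and "open \<Omega>" "bounded \<Omega>" and cont: "continuous_on (closure \<Omega>) f"
    and harm: "\<And>x. x \<in> \<Omega> \<Longrightarrow> harmonic_at f x"
    and "B > 0"
    and bd: "\<And>x. x \<in> frontier \<Omega> \<Longrightarrow> x \<noteq> p \<Longrightarrow> A + B * ln (norm (x - p)) \<le> f x"
    and a: "a \<in> \<Omega>" "a \<noteq> p"
  shows "A + B * ln (norm (a - p)) \<le> f a"
proof -
  have comp: "compact (closure \<Omega>)" using assms by simp
  have ne: "closure \<Omega> \<noteq> {}" using a closure_subset by blast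
  obtain M where M: "\<And>x. x \<in> closure \<Omega> \<Longrightarrow> M \<le> f x"
    using continuous_attains_inf[OF comp ne cont] by metis
  \<comment> \<open>The first bound pushes the logarithm on the small circle below the minorant
    \<open>M\<close> of \<open>f\<close>; the second keeps \<open>a\<close> outside the removed
    disk.\<close>
  define e where "e = min (exp ((M - A) / B)) (norm (a - p) / 2)"
  have e: "e > 0" "e < norm (a - p)" using a by (auto simp: e_def min_less_iff_disj)
  have "e \<le> exp ((M - A) / B)" by (simp add: e_def)
  then have "ln e \<le> ln (exp ((M - A) / B))" using e(1) by (intro ln_mono) auto
  then have "ln e \<le> (M - A) / B" by simp
  then have lne: "A + B * ln e \<le> M" using \<open>B > 0\<close> by (simp add: field_simps)
  define V where "V = \<Omega> - cball p e"
  have oV: "open V" using assms(2) by (simp add: V_def open_Diff)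
  have bV: "bounded V" using assms(3) unfolding V_def by (rule bounded_subset) auto
  have clV: "closure V \<subseteq> closure \<Omega>" unfolding V_def by (intro closure_mono) auto
  have clVp: "e \<le> norm (x - p)" if "x \<in> closure V" for x
  proof -
    have "closure V \<subseteq> - ball p e"
      by (rule closure_minimal) (auto simp: V_def)
    then show ?thesis using that by (auto simp: dist_norm norm_minus_commute)
  qed
  show ?thesis
  proof (rule comparison_principle[OF oV bV, of "\<lambda>x. A + B * ln (norm (x - p))" f])
    show "continuous_on (closure V) (\<lambda>x. A + B * ln (norm (x - p)))"
      by (intro continuous_intros) (use clVp e in force)
    show "continuous_on (closure V) f" using cont clV continuous_on_subset by blast
    show "harmonic_at (\<lambda>x. A + B * ln (norm (x - p))) x" if "x \<in> V" for x
      by (rule harmonic_at_log[OF dim]) (use that e in \<open>auto simp: V_def\<close>)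
    show "harmonic_at f x" if "x \<in> V" for x using harm that by (auto simp: V_def)
    show "a \<in> closure V"
      using a e closure_subset[of V] by (auto simp: V_def dist_norm norm_minus_commute)
    fix x assume x: "x \<in> frontier V"
    then have xc: "x \<in> closure V" and "x \<notin> V" by (auto simp: frontier_def interior_open[OF oV])
    show "A + B * ln (norm (x - p)) \<le> f x"
    proof (cases "x \<in> \<Omega>")
      case True
      then have "norm (x - p) \<le> e" using \<open>x \<notin> V\<close> by (auto simp: V_def dist_norm norm_minus_commute)
      then have "norm (x - p) = e" using clVp[OF xc] by simp
      then show ?thesis using lne M[of x] clV xc by auto
    next
      case False
      then have "x \<in> frontier \<Omega>"
        using xc clV assms(2) by (auto simp: frontier_def interior_open)
      moreover have "x \<noteq> p" using clVp[OF xc] e by auto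
      ultimately show ?thesis by (rule bd)
    qed
  qed
qed

subsection \<open>The gradient of the Robin function\<close>

text \<open>The constant 7 is 6 from the two gradient bounds \<open>2 u / d\<close> and \<open>4 u / d\<close> with
  \<open>u \<le> d / (\<pi> r)\<close>, plus 1 from the explicit kernel of the exterior disk.\<close>
lemma robin_function_gradient:
  fixes k :: "real^2 \<Rightarrow> real^2 \<Rightarrow> real"
  assumes \<Omega>: "open \<Omega>" "bounded \<Omega>" and green: "green_regular_part \<Omega> k"
    and a: "a \<in> \<Omega>" and d: "d > 0" "ball a d \<subseteq> \<Omega>"
    and r: "r > 0" and \<nu>: "norm \<nu> = 1"
    and int: "ball (a - (r - d) *\<^sub>R \<nu>) r \<subseteq> \<Omega>" and dr: "d < r"
    and ext: "ball (a + (r + d) *\<^sub>R \<nu>) r \<subseteq> - \<Omega>"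
  shows "\<exists>G. GDERIV (\<lambda>z. k z z) a :> G \<and> norm (G + (1 / (2 * pi * d)) *\<^sub>R \<nu>) \<le> 7 / (pi * r)"
proof -
  have dim: "DIM(real^2) = 2" by simp
  define c where "c = a + (r + d) *\<^sub>R \<nu>"
  define c' where "c' = a - (r - d) *\<^sub>R \<nu>"
  have ac: "a - c = - ((r + d) *\<^sub>R \<nu>)" by (simp add: c_def)
  have ac': "a - c' = (r - d) *\<^sub>R \<nu>" by (simp add: c'_def)
  have nac: "norm (a - c) = r + d" unfolding ac using \<nu> r d by simp
  have nac': "norm (a - c') = r - d" unfolding ac' using \<nu> dr by simp
  have fr: "x \<notin> \<Omega>" "x \<in> closure \<Omega>" if "x \<in> frontier \<Omega>" for x
    using that \<Omega>(1) by (auto simp: frontier_def interior_open)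
  have k_cont: "continuous_on (closure \<Omega>) (\<lambda>x. k x y)" if "y \<in> \<Omega>" for y
    using green that unfolding green_regular_part_def by blast
  have k_C2: "C2_on (\<lambda>x. k x y) \<Omega>" if "y \<in> \<Omega>" for y
    using green that unfolding green_regular_part_def by blast
  have k_lap: "laplacian (\<lambda>x. k x y) x = 0" if "y \<in> \<Omega>" "x \<in> \<Omega>" for x y
    using green that unfolding green_regular_part_def by fastforce
  have k_bd: "k x y = 1 / (2 * pi) * ln (norm (x - y))" if "y \<in> \<Omega>" "x \<in> frontier \<Omega>" for x y
    using green that unfolding green_regular_part_def by blast
  have k_harm: "harmonic_at (\<lambda>x. k x y) x" if "y \<in> \<Omega>" "x \<in> \<Omega>" for x y
    by (rule harmonic_at_of_C2_laplacian[OF k_C2[OF that(1)] \<Omega>(1) that(2) k_lap[OF that]])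
  have cl_ext: "r \<le> norm (x - c)" if "x \<in> closure \<Omega>" for x
  proof -
    have "closure \<Omega> \<subseteq> - ball c r"
      by (rule closure_minimal) (use ext in \<open>auto simp: c_def\<close>)
    then show ?thesis using that by (auto simp: dist_norm norm_minus_commute)
  qed
  \<comment> \<open>As \<open>\<Omega>\<close> is open, a point on the circle could be moved a
    little towards \<open>c\<close> within \<open>\<Omega>\<close>, into the exterior disk.\<close>
  have op_ext: "r < norm (x - c)" if "x \<in> \<Omega>" for x
  proof (rule ccontr)
    assume "\<not> ?thesis"
    then have eq: "norm (x - c) = r" using cl_ext[of x] that closure_subset by force
    obtain e where e: "e > 0" "ball x e \<subseteq> \<Omega>" using \<Omega>(1) \<open>x \<in> \<Omega>\<close> openE by blast
    define t where "t = min 1 (e / r) / 2"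
    have t: "0 < t" "t < 1" "t * r < e" using e r by (auto simp: t_def min_def field_simps)
    have "x - t *\<^sub>R (x - c) \<in> ball x e" using t eq by (simp add: dist_norm)
    then have "r \<le> norm (x - t *\<^sub>R (x - c) - c)" using e(2) cl_ext closure_subset by blast
    also have "x - t *\<^sub>R (x - c) - c = (1 - t) *\<^sub>R (x - c)" by (simp add: algebra_simps)
    also have "norm \<dots> = (1 - t) * r" using t eq by simp
    finally show False using t r by simp
  qed
  \<comment> \<open>Points outside the exterior disk reflect into it, so its kernel has no
    singularity on \<open>closure \<Omega>\<close>.\<close>
  have refl: "reflection_point c r y \<notin> closure \<Omega>" if "y \<in> \<Omega>" for y
  proof
    assume "reflection_point c r y \<in> closure \<Omega>"
    then have "r \<le> norm (reflection_point c r y - c)" by (rule cl_ext)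
    also have "\<dots> = r\<^sup>2 / norm (y - c)"
      by (rule norm_reflection_point) (use op_ext[OF that] r in auto)
    also have "\<dots> < r" using op_ext[OF that] r by (simp add: power2_eq_square divide_less_eq)
    finally show False by simp
  qed
  have nec: "y \<noteq> c" if "y \<in> \<Omega>" for y using op_ext[OF that] r by auto
  define u where "u x y = disk_kernel c r x y - k x y" for x y
  have K_harm: "harmonic_at (\<lambda>x. disk_kernel c r x y) x" if "y \<in> \<Omega>" "x \<in> \<Omega>" for x y
    by (rule harmonic_at_disk_kernel[OF dim r nec[OF that(1)]])
      (use refl[OF that(1)] that(2) closure_subset in blast)
  have K_cont: "continuous_on (closure \<Omega>) (\<lambda>x. disk_kernel c r x y)" if "y \<in> \<Omega>" for y
    by (rule continuous_on_disk_kernel[OF r nec[OF that] refl[OF that]])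
  have u_harm: "harmonic_at (\<lambda>x. u x y) x" if "y \<in> \<Omega>" "x \<in> \<Omega>" for x y
    unfolding u_def by (intro harmonic_at_diff K_harm k_harm that)
  have u_cont: "continuous_on (closure \<Omega>) (\<lambda>x. u x y)" if "y \<in> \<Omega>" for y
    unfolding u_def by (intro continuous_intros K_cont k_cont that)
  have u_bd: "u x y = disk_kernel c r x y - 1 / (2 * pi) * ln (norm (x - y))"
    if "y \<in> \<Omega>" "x \<in> frontier \<Omega>" for x y using k_bd[OF that] by (simp add: u_def)
  have u_pos: "0 \<le> u x y" if "y \<in> \<Omega>" "x \<in> closure \<Omega>" for x y
  proof (rule minimum_principle[OF \<Omega> u_cont[OF that(1)] u_harm[OF that(1)] _ that(2)])
    fix x assume x: "x \<in> frontier \<Omega>"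
    have "1 / (2 * pi) * ln (norm (x - y)) \<le> disk_kernel c r x y"
      by (rule ln_le_disk_kernel)
        (use r that(1) fr[OF x] cl_ext[of x] op_ext[OF that(1)] in auto)
    then show "0 \<le> u x y" using u_bd[OF that(1) x] by simp
  qed
  have ac0: "a \<noteq> c'" using nac' dr by auto
  define p' where "p' = reflection_point c' r a"
  have ap': "a \<noteq> p'"
  proof
    assume "a = p'"
    then have "r - d = r\<^sup>2 / (r - d)"
      using norm_reflection_point[OF ac0, of r] nac' by (simp add: p'_def)
    then have "(r - d) * (r - d) = r * r" using dr by (simp add: power2_eq_square field_simps)
    moreover have "(r - d) * (r - d) < r * r" using dr d by (intro mult_strict_mono) auto
    ultimately show False by simp
  qed
  \<comment> \<open>The frontier of \<open>\<Omega>\<close> lies outside the interior disk and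
    \<open>a\<close> inside it, so the inequality for opposite sides applies. Comparing on
    \<open>\<Omega>\<close> rather than on the disk makes the known boundary values of
    \<open>k\<close> available.\<close>
  have K'_le: "disk_kernel c' r a a \<le> k a a"
    unfolding disk_kernel_eq_ln[OF r ac0 ap'[unfolded p'_def]]
  proof (rule log_comparison[OF dim \<Omega> k_cont[OF a] k_harm[OF a]])
    fix x assume x: "x \<in> frontier \<Omega>" "x \<noteq> reflection_point c' r a"
    have "x \<notin> ball c' r" using fr(1)[OF x(1)] int unfolding c'_def by blast
    then have "r \<le> norm (x - c')" by (simp add: dist_norm norm_minus_commute)
    then have "disk_kernel c' r x a \<le> 1 / (2 * pi) * ln (norm (x - a))"
      by (intro disk_kernel_le_ln[OF r _ ac0 x(2)]) (use a fr(1)[OF x(1)] nac' d in auto)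
    then show "1 / (4 * pi) * ln ((norm (a - c'))\<^sup>2 / r\<^sup>2)
        + 1 / (2 * pi) * ln (norm (x - reflection_point c' r a)) \<le> k x a"
      using k_bd[OF a x(1)] disk_kernel_eq_ln[OF r ac0 x(2)] by simp
  qed (use a ap' in \<open>auto simp: p'_def\<close>)
  define B where "B = d * (2 * r + d)"
  have B: "(norm (a - c))\<^sup>2 - r\<^sup>2 = B" "B > 0"
    unfolding nac B_def using r d(1) by (simp add: power2_eq_square algebra_simps) (simp add: r d(1) add_pos_pos)
  have u0: "u a a \<le> d / (pi * r)"
  proof -
    have K1: "disk_kernel c r a a = 1 / (2 * pi) * ln (d * (2 * r + d) / r)"
      using disk_kernel_diag[OF r, of a c] B nac d unfolding B_def by simp
    have "\<bar>(norm (a - c'))\<^sup>2 - r\<^sup>2\<bar> = d * (2 * r - d)"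
    proof -
      have "(norm (a - c'))\<^sup>2 - r\<^sup>2 = - (d * (2 * r - d))"
        unfolding nac' by (simp add: power2_eq_square algebra_simps)
      then show ?thesis using d dr by (simp add: abs_mult)
    qed
    then have K2: "disk_kernel c' r a a = 1 / (2 * pi) * ln (d * (2 * r - d) / r)"
      using disk_kernel_diag[OF r, of a c'] nac' d by simp
    have "u a a \<le> disk_kernel c r a a - disk_kernel c' r a a"
      using K'_le by (simp add: u_def)
    \<comment> \<open>The singular terms ln d cancel. By ln t <= t - 1 the difference is at most 2 d
      / (2 r - d), and \<open>d < r\<close> makes this at most 2 d / r.\<close>
    also have "\<dots> = 1 / (2 * pi) * (ln (d * (2 * r + d) / r) - ln (d * (2 * r - d) / r))"
      unfolding K1 K2 by (simp add: right_diff_distrib)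
    also have "ln (d * (2 * r + d) / r) - ln (d * (2 * r - d) / r) = ln ((2 * r + d) / (2 * r - d))"
      using d r dr by (simp add: ln_div ln_mult)
    also have "\<dots> \<le> (2 * r + d) / (2 * r - d) - 1"
      using d r dr by (intro ln_le_minus_one) auto
    also have "\<dots> = 2 * d / (2 * r - d)" using dr d by (simp add: field_simps)
    also have "\<dots> \<le> 2 * d / r" using dr d by (intro divide_left_mono) auto
    finally show ?thesis by (simp add: field_simps)
  qed
  have u0_pos: "0 \<le> u a a" using u_pos[OF a] a closure_subset by blast
  have far: "d \<le> norm (x - a)" if "x \<in> frontier \<Omega>" for x
  proof -
    have "x \<notin> ball a d" using fr(1)[OF that] d(2) by blast
    then show ?thesis by (simp add: dist_norm norm_minus_commute)
  qed
  have near: "a + v \<in> \<Omega>" if "norm v < d" for v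
  proof -
    have "a + v \<in> ball a d" using that by (simp add: dist_norm)
    then show ?thesis using d(2) by blast
  qed
  \<comment> \<open>The linear map supplied below is the derivative of the boundary values in the
    pole; the radius \<open>d / 8\<close> is that of \<open>ln_norm_taylor\<close>, as boundary
    points are at distance at least \<open>d\<close> from \<open>a\<close>.\<close>
  obtain w where w_cont: "continuous_on (closure \<Omega>) w"
    and w: "\<And>x v. x \<in> closure \<Omega> \<Longrightarrow> norm v < d / 8 \<Longrightarrow>
        \<bar>k x (a + v) - k x a - w x \<bullet> v\<bar> \<le> (10 / d\<^sup>2 / (2 * pi)) * (norm v)\<^sup>2"
  proof (rule harmonic_family_differentiable[OF \<Omega>, of "d / 8" "10 / d\<^sup>2 / (2 * pi)" k a
        "\<lambda>x v. - (1 / (2 * pi)) * (((x - a) \<bullet> v) / (norm (x - a))\<^sup>2)"])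
    show "continuous_on (closure \<Omega>) (\<lambda>x. k x (a + v))" if "norm v < d / 8" for v
      by (intro k_cont near) (use that d in simp)
    show "harmonic_at (\<lambda>x. k x (a + v)) x" if "norm v < d / 8" "x \<in> \<Omega>" for v x
      by (intro k_harm near that(2)) (use that d in simp)
    show "linear (\<lambda>v. - (1 / (2 * pi)) * (((x - a) \<bullet> v) / (norm (x - a))\<^sup>2))" for x
      by (rule linearI) (simp_all add: inner_add_right add_divide_distrib distrib_left)
    fix x v assume x: "x \<in> frontier \<Omega>" and v: "norm (v :: real^2) < d / 8"
    have "\<bar>ln (norm ((x - a) - v)) - ln (norm (x - a)) + ((x - a) \<bullet> v) / (norm (x - a))\<^sup>2\<bar>
        \<le> 10 / d\<^sup>2 * (norm v)\<^sup>2"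
      by (rule ln_norm_taylor) (use d far[OF x] v in auto)
    then have "1 / (2 * pi) * \<bar>ln (norm ((x - a) - v)) - ln (norm (x - a)) + ((x - a) \<bullet> v) / (norm (x - a))\<^sup>2\<bar>
        \<le> 1 / (2 * pi) * (10 / d\<^sup>2 * (norm v)\<^sup>2)" by (intro mult_left_mono) auto
    also have "1 / (2 * pi) * \<bar>ln (norm ((x - a) - v)) - ln (norm (x - a)) + ((x - a) \<bullet> v) / (norm (x - a))\<^sup>2\<bar>
        = \<bar>1 / (2 * pi) * (ln (norm ((x - a) - v)) - ln (norm (x - a)) + ((x - a) \<bullet> v) / (norm (x - a))\<^sup>2)\<bar>"
      unfolding abs_mult by simp
    also have "1 / (2 * pi) * (ln (norm ((x - a) - v)) - ln (norm (x - a)) + ((x - a) \<bullet> v) / (norm (x - a))\<^sup>2)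
        = k x (a + v) - k x a - - (1 / (2 * pi)) * (((x - a) \<bullet> v) / (norm (x - a))\<^sup>2)"
    proof -
      have "a + v \<in> \<Omega>" by (rule near) (use v d in simp)
      then show ?thesis
        using k_bd[OF _ x] a by (simp add: distrib_left right_diff_distrib diff_diff_eq)
    qed
    finally show "\<bar>k x (a + v) - k x a - - (1 / (2 * pi)) * (((x - a) \<bullet> v) / (norm (x - a))\<^sup>2)\<bar>
        \<le> 10 / d\<^sup>2 / (2 * pi) * (norm v)\<^sup>2" by simp
  qed (use d in auto)
  obtain D where D: "((\<lambda>x. k x a) has_derivative D) (at a)"
    using k_C2[OF a] a unfolding C2_on_def by blast
  have w': "\<And>x v. x \<in> \<Omega> \<Longrightarrow> norm v < d / 8 \<Longrightarrow>
        \<bar>k x (a + v) - k x a - w x \<bullet> v\<bar> \<le> (10 / d\<^sup>2 / (2 * pi)) * (norm v)\<^sup>2"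
    using w closure_subset by blast
  have w_cont': "continuous_on \<Omega> w" using w_cont closure_subset continuous_on_subset by blast
  have d8: "d / 8 > 0" using d by simp
  note diag = diagonal_has_derivative[where k = k, OF \<Omega>(1) a d8 w_cont' w' D]
  define m where "m = (1 / (2 * pi) / B) *\<^sub>R (a - c)"
  have Kd: "((\<lambda>x. disk_kernel c r x a) has_derivative (\<lambda>v. m \<bullet> v)) (at a)"
    using disk_kernel_has_derivative[OF r op_ext[OF a]] unfolding B(1) by (simp add: m_def)
  have uy: "\<bar>m \<bullet> v - w a \<bullet> v\<bar> \<le> 4 * u a a / d * norm v" for v
  proof (rule harnack_imp_gradient_bound[OF d(1), where f = "\<lambda>y. u a y" and x = a
        and D = "\<lambda>v. m \<bullet> v - w a \<bullet> v"])
    have "((\<lambda>y. disk_kernel c r a y) has_derivative (\<lambda>v. m \<bullet> v)) (at a)"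
      using Kd by (simp add: disk_kernel_commute[of c r a])
    then show "((\<lambda>y. u a y) has_derivative (\<lambda>v. m \<bullet> v - w a \<bullet> v)) (at a)"
      unfolding u_def by (rule has_derivative_diff[OF _ diag(2)])
    fix y assume y: "y \<in> ball a d"
    then have y\<Omega>: "y \<in> \<Omega>" using d(2) by blast
    \<comment> \<open>With \<open>y\<close> fixed, the comparison runs over the first variable,
      between \<open>u x y\<close> and a multiple of \<open>u x a\<close>, and is read off at
      \<open>x = a\<close>.\<close>
    show "u a y \<le> ((d + dist a y) / (d - dist a y))\<^sup>2 * u a a"
    proof (rule comparison_principle[OF \<Omega>, where a = a and f = "\<lambda>x. u x y"
          and g = "\<lambda>x. ((d + dist a y) / (d - dist a y))\<^sup>2 * u x a"])
      show "continuous_on (closure \<Omega>) (\<lambda>x. ((d + dist a y) / (d - dist a y))\<^sup>2 * u x a)"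
        by (intro continuous_on_mult continuous_on_const u_cont[OF a])
      show "harmonic_at (\<lambda>x. ((d + dist a y) / (d - dist a y))\<^sup>2 * u x a) x" if "x \<in> \<Omega>" for x
        by (intro harmonic_at_cmult u_harm a that)
      show "a \<in> closure \<Omega>" using a closure_subset by blast
      fix x assume x: "x \<in> frontier \<Omega>"
      show "u x y \<le> ((d + dist a y) / (d - dist a y))\<^sup>2 * u x a"
        unfolding u_bd[OF y\<Omega> x] u_bd[OF a x]
        by (rule disk_kernel_harnack[OF r d(1) nac])
          (use y far[OF x] cl_ext[OF fr(2)[OF x]] op_ext[OF y\<Omega>] in auto)
    qed (use u_cont[OF y\<Omega>] u_harm[OF y\<Omega>] in auto)
  qed
  define p where "p = reflection_point c r a"
  have pcl: "p \<notin> closure \<Omega>" using refl[OF a] by (simp add: p_def)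
  define A where "A = 1 / (4 * pi) * ln ((norm (a - c))\<^sup>2 / r\<^sup>2)"
  have u_ln: "u x a = A + 1 / (2 * pi) * ln (norm (x - p)) - k x a" if "x \<noteq> p" for x
    using disk_kernel_eq_ln[OF r nec[OF a], of x] that by (simp add: u_def p_def A_def)
  have ap: "a \<noteq> p" using pcl a closure_subset by blast
  have ux: "\<bar>m \<bullet> v - D v\<bar> \<le> 2 * u a a / d * norm v" for v
    unfolding u_ln[OF ap]
  proof (rule positive_log_minus_harmonic_gradient[OF dim d(1), where k = "\<lambda>x. k x a"
        and A = A and B = "1 / (2 * pi)" and p = p and x = a and D = "\<lambda>v. m \<bullet> v - D v"])
    show "C2_on (\<lambda>x. k x a) (ball a d)"
      using k_C2[OF a] d(2) unfolding C2_on_def by (meson continuous_on_subset subsetD)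
    show "laplacian (\<lambda>x. k x a) z = 0" if "z \<in> ball a d" for z
      using k_lap[OF a] that d(2) by blast
    show pb: "p \<notin> ball a d" using pcl d(2) closure_subset by blast
    show "0 \<le> A + 1 / (2 * pi) * ln (norm (z - p)) - k z a" if "z \<in> ball a d" for z
    proof -
      have "z \<in> closure \<Omega>" using that d(2) closure_subset by blast
      moreover have "z \<noteq> p" using pb that by blast
      ultimately show ?thesis using u_pos[OF a] u_ln by metis
    qed
    have "((\<lambda>x. u x a) has_derivative (\<lambda>v. m \<bullet> v - D v)) (at a)"
      unfolding u_def by (rule has_derivative_diff[OF Kd D])
    then show "((\<lambda>z. A + 1 / (2 * pi) * ln (norm (z - p)) - k z a) has_derivative (\<lambda>v. m \<bullet> v - D v)) (at a)"
      by (rule has_derivative_transform_within_open[where s = "- {p}"]) (use ap u_ln in auto)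
  qed
  have lin: "linear D" using D by (rule has_derivative_linear)
  define g where "g = (\<Sum>b\<in>Basis. D b *\<^sub>R b)"
  have g: "D v = g \<bullet> v" for v
  proof -
    have "D v = D (\<Sum>b\<in>Basis. (v \<bullet> b) *\<^sub>R b)" by (simp add: euclidean_representation)
    also have "\<dots> = (\<Sum>b\<in>Basis. (v \<bullet> b) * D b)" using lin by (simp add: linear_sum linear_cmul)
    also have "\<dots> = g \<bullet> v" unfolding g_def inner_sum_left by (simp add: inner_commute mult.commute)
    finally show ?thesis .
  qed
  define G where "G = g + w a"
  have "norm (G - 2 *\<^sub>R m) \<le> 6 / (pi * r)"
  proof -
    \<comment> \<open>Both directional bounds are tested with \<open>z\<close> itself and a factor
      \<open>norm z\<close> is cancelled; 6 is 2 + 4.\<close>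
    define z where "z = G - 2 *\<^sub>R m"
    have "(norm z)\<^sup>2 = z \<bullet> z" by (rule power2_norm_eq_inner)
    also have "\<dots> = - (m \<bullet> z - D z) - (m \<bullet> z - w a \<bullet> z)"
      by (subst (1) z_def) (simp add: G_def g inner_add_left inner_diff_left)
    also have "\<dots> \<le> 2 * u a a / d * norm z + 4 * u a a / d * norm z"
      using ux[of z] uy[of z] by linarith
    also have "\<dots> = (6 * u a a / d) * norm z" by (simp add: add_divide_distrib[symmetric] distrib_right[symmetric])
    finally have "norm z * norm z \<le> (6 * u a a / d) * norm z" by (simp add: power2_eq_square)
    then have "norm z \<le> 6 * u a a / d \<or> norm z = 0"
      unfolding mult_le_cancel_right using norm_ge_zero[of z] by linarith
    then have "norm z \<le> 6 * u a a / d" using u0_pos d(1) by auto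
    also have "\<dots> \<le> 6 * (d / (pi * r)) / d" using u0 d(1) by (intro divide_right_mono) auto
    also have "\<dots> = 6 / (pi * r)" using d(1) by simp
    finally show ?thesis by (simp add: z_def)
  qed
  moreover have "norm (2 *\<^sub>R m + (1 / (2 * pi * d)) *\<^sub>R \<nu>) \<le> 1 / (pi * r)"
  proof -
    have "2 *\<^sub>R m = (2 * (1 / (2 * pi) / B)) *\<^sub>R (a - c)" by (simp add: m_def)
    also have "2 * (1 / (2 * pi) / B) = 1 / (pi * B)" by simp
    finally have "2 *\<^sub>R m = - ((r + d) / (pi * B)) *\<^sub>R \<nu>" by (simp add: ac)
    then have "2 *\<^sub>R m + (1 / (2 * pi * d)) *\<^sub>R \<nu> = (1 / (2 * pi * d) - (r + d) / (pi * B)) *\<^sub>R \<nu>"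
      by (simp add: scaleR_left_diff_distrib)
    \<comment> \<open>The singularities 1 / d cancel: with B = d (2 r + d), the numerator (2 r + d)
      - 2 (r + d) equals - d.\<close>
    also have "1 / (2 * pi * d) - (r + d) / (pi * B) = - (1 / (2 * pi * (2 * r + d)))"
      unfolding B_def using d(1) r by (simp add: divide_simps add_pos_pos)
    finally have "norm (2 *\<^sub>R m + (1 / (2 * pi * d)) *\<^sub>R \<nu>) = 1 / (2 * pi * (2 * r + d))"
      using \<nu> r d(1) by simp
    also have "\<dots> \<le> 1 / (pi * r)"
    proof (rule frac_le)
      have "pi * r \<le> pi * (2 * (2 * r + d))" using r d(1) by (intro mult_left_mono) auto
      then show "pi * r \<le> 2 * pi * (2 * r + d)" by (simp add: mult.left_commute mult.assoc)
    qed (use r in auto)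
    finally show ?thesis .
  qed
  moreover have "G + (1 / (2 * pi * d)) *\<^sub>R \<nu> = (G - 2 *\<^sub>R m) + (2 *\<^sub>R m + (1 / (2 * pi * d)) *\<^sub>R \<nu>)"
    by simp
  ultimately have "norm (G + (1 / (2 * pi * d)) *\<^sub>R \<nu>) \<le> 6 / (pi * r) + 1 / (pi * r)"
    using norm_triangle_mono by metis
  also have "\<dots> = 7 / (pi * r)" by (simp add: add_divide_distrib[symmetric])
  finally have "norm (G + (1 / (2 * pi * d)) *\<^sub>R \<nu>) \<le> 7 / (pi * r)" .
  moreover have "GDERIV (\<lambda>z. k z z) a :> G"
    using diag(1) unfolding gderiv_def by (simp add: G_def g inner_add_right inner_commute)
  ultimately show ?thesis by blast
qed

theorem lemma2p4:
  fixes \<sigma> :: real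
  assumes "0 < \<sigma>" and "\<sigma> < 1"
  shows "\<exists>C>0. \<forall>(\<Omega> :: (real^2) set) (\<rho> :: real) (k :: real^2 \<Rightarrow> real^2 \<Rightarrow> real)
                 (x :: real^2) (s :: real^2) (\<nu> :: real^2).
           bounded \<Omega> \<and> open \<Omega> \<and> connected \<Omega> \<and> C2_boundary \<Omega> \<and>
           0 < \<rho> \<and> disk_conditions \<Omega> \<rho> \<and>
           green_regular_part \<Omega> k \<and>
           x \<in> \<Omega> \<and> infdist x (frontier \<Omega>) \<le> \<sigma> * \<rho> \<and>
           s \<in> frontier \<Omega> \<and> dist x s = infdist x (frontier \<Omega>) \<and>
           outward_unit_normal \<Omega> s \<nu>
           \<longrightarrow>
           (\<exists>grad_h. GDERIV (\<lambda>z. k z z) x :> grad_h \<and>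
              norm (grad_h + (1 / (2 * pi * infdist x (frontier \<Omega>))) *\<^sub>R \<nu>) \<le> C / (pi * \<rho>))"
\<comment> \<open>One constant serves every \<open>\<sigma>\<close>: from
  \<open>\<sigma> < 1\<close> comes \<open>d < \<rho>\<close>, and the estimate works with
  that.\<close>
proof (rule exI[of _ 7], intro conjI allI impI)
  fix \<Omega> :: "(real^2) set" and \<rho> k x s \<nu>
  assume H: "bounded \<Omega> \<and> open \<Omega> \<and> connected \<Omega> \<and> C2_boundary \<Omega> \<and>
           0 < \<rho> \<and> disk_conditions \<Omega> \<rho> \<and>
           green_regular_part \<Omega> k \<and>
           x \<in> \<Omega> \<and> infdist x (frontier \<Omega>) \<le> \<sigma> * \<rho> \<and>
           s \<in> frontier \<Omega> \<and> dist x s = infdist x (frontier \<Omega>) \<and>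
           outward_unit_normal \<Omega> s \<nu>"
  define d where "d = infdist x (frontier \<Omega>)"
  have "s \<notin> \<Omega>" using H by (auto simp: frontier_def interior_open)
  then have "x \<noteq> s" using H by blast
  then have d: "d > 0" "dist x s = d" using H by (auto simp: d_def[symmetric] zero_less_dist_iff[symmetric])
  have ball: "ball x d \<subseteq> \<Omega>" unfolding d_def using H by (intro ball_infdist_frontier_subset) auto
  have "d \<le> \<sigma> * \<rho>" using H by (simp add: d_def)
  also have "\<dots> < \<rho>" using assms H by simp
  finally have d\<rho>: "d < \<rho>" .
  obtain ci ce where c: "ball ci \<rho> \<subseteq> \<Omega>" "ball ce \<rho> \<subseteq> - \<Omega>"
    "sphere ci \<rho> \<inter> frontier \<Omega> \<inter> sphere ce \<rho> = {s}"
    using H unfolding disk_conditions_def by fastforce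
  then have dist: "dist ci s = \<rho>" "dist ce s = \<rho>" by auto
  \<comment> \<open>The distance disk about \<open>x\<close> and the interior disk both touch
    \<open>s\<close> from within, so both centres lie on the normal line through \<open>s\<close>;
    the tangent exterior disk then has its centre there too.\<close>
  have x: "s = x + d *\<^sub>R \<nu>"
    by (rule outward_unit_normal_interior_disk[of \<Omega>]) (use H ball d in auto)
  have ci: "s = ci + \<rho> *\<^sub>R \<nu>"
    by (rule outward_unit_normal_interior_disk[of \<Omega>]) (use H c dist in auto)
  have opp: "ce - s = s - ci"
    by (rule opposite_tangent_disks[of _ \<rho>]) (use H c dist in auto)
  have "s - ci = \<rho> *\<^sub>R \<nu>" using ci by (metis add_diff_cancel_left')
  then have "ce = s + \<rho> *\<^sub>R \<nu>" using opp by (simp add: diff_eq_eq add.commute)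
  then have ce': "ce = x + (\<rho> + d) *\<^sub>R \<nu>" by (simp add: x scaleR_add_left)
  have ci': "ci = x - (\<rho> - d) *\<^sub>R \<nu>" using x ci by (simp add: algebra_simps)
  have "\<exists>G. GDERIV (\<lambda>z. k z z) x :> G \<and> norm (G + (1 / (2 * pi * d)) *\<^sub>R \<nu>) \<le> 7 / (pi * \<rho>)"
    by (rule robin_function_gradient[of \<Omega>])
      (use H d ball d\<rho> c norm_outward_unit_normal[of \<Omega> s \<nu>] in \<open>auto simp: ce' ci'\<close>)
  then show "\<exists>grad_h. GDERIV (\<lambda>z. k z z) x :> grad_h \<and>
      norm (grad_h + (1 / (2 * pi * infdist x (frontier \<Omega>))) *\<^sub>R \<nu>) \<le> 7 / (pi * \<rho>)"
    by (simp add: d_def)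
qed simp

end
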